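(* Let $u^k$ be the rescaled functions defined in the context. Let $k_n\to\infty$ be such that $u^{k_n}\to U$ uniformly on compact sets of $\mathbb R^N\times(0,\infty)$. Then $U$ is a solution in $\mathbb R^N\times(0,\infty)$ of $$U_t-\mathfrak a\Delta U=-c_0U^p,\qquad\text{where } c_0=\lim_{k\to\infty}F(k).$$
   Context: $J\in C_0^\infty(\mathbb R^N)$ is radially symmetric, $J\ge0$, $\int J=1$, $\mathfrak a=\frac1{2N}\int J(x)|x|^2\,dx$; $p>1$; $0\le u_0\in L^\infty(\mathbb R^N)$, $u_0\neq0$, and there is $\kappa>0$ with $\int_{B_k}u_0\ge\kappa k^N$ for all small $k>0$, where $B_k$ is the ball of radius $k$ centered at $0$. Put $$f(k)=\frac{k^N}{\int_{B_k}u_0},\qquad F(k)=f(k)^{1-p}k^2 .$$ Assume: (F1) there is $B>0$ with $f(|x|)u_0(x)\le B$; (F2) there is $k_0>0$ such that for every $\delta>0$ there is $C_\delta>0$ with $f(k)\le C_\delta f(l)$ whenever $k_0\le k\le l\delta^{-1}$; (F3) there is $c_0\ge0$ with $F(k)\to c_0$ as $k\to\infty$. Let $u$ be the nonnegative bounded solution of $u_t=\int J(x-y)(u(y,t)-u(x,t))\,dy-u^p$ in $\mathbb R^N\times(0,\infty)$, $u(x,0)=u_0(x)$, and set $u^k(x,t)=f(k)\,u(kx,k^2t)$. "Solution" for the limit equation is in the sense of distributions: $\int_0^\infty\!\int U(\varphi_t+\mathfrak a\Delta\varphi)=c_0\int_0^\infty\!\int U^p\varphi$ for all $\varphi\in C_0^\infty(\mathbb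 R^N\times(0,\infty))$. *)

theory Defs
  imports "HOL-Analysis.Analysis"
begin

text \<open>The space \<open>R\<^sup>N\<close> is an arbitrary Euclidean space \<open>'a\<close> with \<open>N = DIM('a)\<close>.
  Elements of \<open>L\<^sup>\<infinity>\<close> are given by Lebesgue measurable representatives.\<close>

definition dir_deriv :: "'b::euclidean_space \<Rightarrow> ('b \<Rightarrow> real) \<Rightarrow> 'b \<Rightarrow> real"
  where "dir_deriv v g = (\<lambda>z. frechet_derivative g (at z) v)"

fun C_k :: "nat \<Rightarrow> ('b::euclidean_space \<Rightarrow> real) \<Rightarrow> bool" where
  "C_k 0 g \<longleftrightarrow> continuous_on UNIV g"
| "C_k (Suc n) g \<longleftrightarrow> (\<forall>z. g differentiable (at z)) \<and> (\<forall>b\<in>Basis. C_k n (dir_deriv b g))"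

text \<open>Functions of class \<open>C\<^sub>0\<^sup>\<infinity>(\<Omega>)\<close> (smooth, with compact support contained in \<open>\<Omega>\<close>), identified
  with their extension by zero to the whole space.\<close>

definition C0_inf :: "'b::euclidean_space set \<Rightarrow> ('b \<Rightarrow> real) \<Rightarrow> bool" where
  "C0_inf \<Omega> g \<longleftrightarrow> (\<forall>n. C_k n g) \<and>
     compact (closure {z. g z \<noteq> 0}) \<and> closure {z. g z \<noteq> 0} \<subseteq> \<Omega>"

definition L_inf :: "('b::euclidean_space \<Rightarrow> real) \<Rightarrow> bool" where
  "L_inf g \<longleftrightarrow> g \<in> borel_measurable lebesgue \<and> (\<exists>M. AE x in lebesgue. \<bar>g x\<bar> \<le> M)"

definition locally_integrable_on :: "('b::euclidean_space \<Rightarrow> real) \<Rightarrow> 'b set \<Rightarrow> bool" where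
  "locally_integrable_on g \<Omega> \<longleftrightarrow> (\<forall>K. compact K \<and> K \<subseteq> \<Omega> \<longrightarrow> set_integrable lebesgue K g)"

definition spacetime :: "('a::euclidean_space \<times> real) set" where
  "spacetime = UNIV \<times> {0<..}"

definition time_deriv :: "('a::euclidean_space \<times> real \<Rightarrow> real) \<Rightarrow> 'a \<times> real \<Rightarrow> real" where
  "time_deriv \<phi> = dir_deriv (0, 1) \<phi>"

definition space_laplacian :: "('a::euclidean_space \<times> real \<Rightarrow> real) \<Rightarrow> 'a \<times> real \<Rightarrow> real" where
  "space_laplacian \<phi> z = (\<Sum>b\<in>Basis. dir_deriv (b, 0) (dir_deriv (b, 0) \<phi>) z)"

definition diffusion_coeff :: "('a::euclidean_space \<Rightarrow> real) \<Rightarrow> real" where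
  "diffusion_coeff J = 1 / (2 * DIM('a)) * (LINT x|lebesgue. J x * (norm x)\<^sup>2)"

definition ball_integral :: "('a::euclidean_space \<Rightarrow> real) \<Rightarrow> real \<Rightarrow> real" where
  "ball_integral u0 k = (LINT x:ball 0 k|lebesgue. u0 x)"

definition f_scale :: "('a::euclidean_space \<Rightarrow> real) \<Rightarrow> real \<Rightarrow> real" where
  "f_scale u0 k = k ^ DIM('a) / ball_integral u0 k"

definition F_scale :: "real \<Rightarrow> ('a::euclidean_space \<Rightarrow> real) \<Rightarrow> real \<Rightarrow> real" where
  "F_scale p u0 k = f_scale u0 k powr (1 - p) * k\<^sup>2"

text \<open>Since \<open>u0\<close> is only an \<open>L\<^sup>\<infinity>\<close> function and the equation does not regularize in \<open>x\<close>, the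
  equation and the initial condition are required for almost every \<open>x\<close> (and then for all times);
  continuity up to \<open>t = 0\<close> ties the solution to its initial value.\<close>

definition nonneg_bounded_solution ::
    "('a::euclidean_space \<Rightarrow> real) \<Rightarrow> real \<Rightarrow> ('a \<Rightarrow> real) \<Rightarrow> ('a \<Rightarrow> real \<Rightarrow> real) \<Rightarrow> bool" where
  "nonneg_bounded_solution J p u0 u \<longleftrightarrow>
     (\<forall>t\<ge>0. (\<lambda>x. u x t) \<in> borel_measurable lebesgue) \<and>
     (\<exists>M. AE x in lebesgue. \<forall>t\<ge>0. 0 \<le> u x t \<and> u x t \<le> M) \<and>
     (AE x in lebesgue. u x 0 = u0 x \<and> continuous_on {0..} (u x) \<and>
        (\<forall>t>0. (u x has_real_derivative
           (LINT y|lebesgue. J (x - y) * (u y t - u x t)) - u x t powr p) (at t)))"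

definition rescaled ::
    "('a::euclidean_space \<Rightarrow> real) \<Rightarrow> ('a \<Rightarrow> real \<Rightarrow> real) \<Rightarrow> real \<Rightarrow> 'a \<Rightarrow> real \<Rightarrow> real" where
  "rescaled u0 u k x t = f_scale u0 k * u (k *\<^sub>R x) (k\<^sup>2 * t)"

text \<open>Solutions of \<open>U\<^sub>t - a \<Delta>U = - c U\<^sup>p\<close> in the sense of distributions. Nonnegativity makes
  \<open>U\<^sup>p\<close> meaningful, and local integrability (which includes measurability) makes both integrals
  genuine rather than the default value 0 of a divergent integral.\<close>

definition distributional_solution ::
    "real \<Rightarrow> real \<Rightarrow> real \<Rightarrow> ('a::euclidean_space \<Rightarrow> real \<Rightarrow> real) \<Rightarrow> bool" where
  "distributional_solution a c p U \<longleftrightarrow>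
     (AE (x, t) in lebesgue. 0 < t \<longrightarrow> 0 \<le> U x t) \<and>
     locally_integrable_on (\<lambda>(x, t). U x t) spacetime \<and>
     locally_integrable_on (\<lambda>(x, t). U x t powr p) spacetime \<and>
     (\<forall>\<phi>. C0_inf spacetime \<phi> \<longrightarrow>
        (LINT (x, t):spacetime|lebesgue. U x t * (time_deriv \<phi> (x, t) + a * space_laplacian \<phi> (x, t)))
        = c * (LINT (x, t):spacetime|lebesgue. U x t powr p * \<phi> (x, t)))"

end

theory Submission
  imports Defs
begin

text \<open>Put \<open>w(x, t) = f(k) u(k x, k\<^sup>2 t)\<close> and \<open>h = 1 / k\<close>. The substitution \<open>y \<mapsto> k x - y\<close> in the
  convolution shows that \<open>w\<close> solves \<open>w\<^sub>t = h\<^bsup>-2\<^esup> L\<^sub>h w - F(k) w\<^sup>p\<close>, where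
  \<open>L\<^sub>h w(x, t) = \<integral> J(y) (w(x - h y, t) - w(x, t)) dy\<close>. Testing with \<open>\<phi>\<close> and moving \<open>L\<^sub>h\<close> onto \<open>\<phi>\<close> by
  Fubini and translation gives \<open>\<integral>\<integral> w (\<phi>\<^sub>t + h\<^bsup>-2\<^esup> L\<^bsub>-h\<^esub> \<phi>) = F(k) \<integral>\<integral> w\<^sup>p \<phi>\<close>. By Taylor's theorem and the
  radial symmetry of \<open>J\<close> (odd and mixed second moments vanish, the pure second moments agree), \<open>h\<^bsup>-2\<^esup> L\<^bsub>-h\<^esub> \<phi>\<close> converges boundedly
  to \<open>a \<Delta> \<phi>\<close>, with supports in a fixed compact subset of \<open>R\<^sup>N \<times> (0, \<infinity>)\<close>. There \<open>w\<close> converges uniformly, so dominated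
  convergence gives the limit equation.\<close>

text \<open>Two gaps separate the hypotheses from these integrations. The function u is measurable
  in x at each fixed time and satisfies the equation for almost every x, whereas Fubini needs joint
  measurability. It is therefore replaced by a Borel function v that agrees with it for all t \<ge>
  0 outside one null set of x; the n-th rescaling discards the preimage of that set under x -> k_n
  x, so countably many null sets in all. Moreover the evident global bound on w is f(k) times a
  bound of u, which may grow with k. It suffices for the weak form at one scale. The majorant for
  the limit is local and comes from the convergence itself: on a compact set all late w_n lie within
  2 of one fixed w_n, which is bounded. The vanishing of the first moments of J matters already for
  boundedness: the first-order Taylor term is of order h and would blow up after division by the
  square of h. Integration by parts in time leaves no boundary term, since the support of a test
  function stays away from t = 0.\<close>

lemma integrable_bounded_support:
  fixes f :: "'b::euclidean_space \<Rightarrow> real"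
  assumes "f \<in> borel_measurable borel" "\<And>x. \<bar>f x\<bar> \<le> C" "bounded S" "\<And>x. x \<notin> S \<Longrightarrow> f x = 0"
  shows "integrable lborel f"
proof -
  obtain r where r: "S \<subseteq> cball 0 r" using bounded_subset_ballD[OF assms(3), of 0] ball_subset_cball by (metis order_trans)
  have *: "integrable lborel (\<lambda>x. indicator (cball 0 r :: 'b set) x * C)"
    by (intro integrable_mult_left integrable_real_indicator) (use emeasure_bounded_finite[OF bounded_cball, of 0 r] in \<open>auto simp: less_top[symmetric]\<close>)
  show ?thesis
  proof (rule Bochner_Integration.integrable_bound[OF *])
    show "f \<in> borel_measurable lborel" using assms(1) by simp
    have "norm (f x) \<le> norm (indicator (cball 0 r) x * C)" for x
      by (cases "x \<in> S") (use assms(2)[of x] assms(4)[of x] r in \<open>auto simp: indicator_def\<close>)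
    then show "AE x in lborel. norm (f x) \<le> norm (indicator (cball 0 r) x * C)" by simp
  qed
qed

section \<open>Moments of radial functions\<close>

text \<open>The map negates the coordinate along \<open>i\<close> and fixes the others. It is
  diagonal, and the absolute values of its factors multiply to 1, so the affine change of variables
  has density 1.\<close>

lemma lborel_distr_reflect:
  fixes i :: "'b::euclidean_space"
  assumes i: "i \<in> Basis"
  shows "distr lborel borel (\<lambda>x. x - (2 * (x \<bullet> i)) *\<^sub>R i) = lborel"
proof -
  let ?c = "\<lambda>j. if j = i then - 1 else (1::real)"
  have "0 + (\<Sum>j\<in>Basis. (?c j * (x \<bullet> j)) *\<^sub>R j) = x - (2 * (x \<bullet> i)) *\<^sub>R i" for x :: 'b
    by (rule euclidean_eqI) (use i in \<open>auto simp: inner_simps inner_Basis inner_sum_left if_distrib cong: if_cong\<close>)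
  moreover have "(\<Prod>j\<in>Basis. \<bar>?c j\<bar>) = 1"
    by (intro prod.neutral) auto
  ultimately show ?thesis
    using lborel_affine_euclidean[of ?c 0] by (simp add: density_1)
qed

text \<open>Exchanging two coordinates is not a diagonal map, so the measure is identified on boxes:
  the preimage of a box is the box with permuted corners, and permuting the side lengths leaves
  their product unchanged.\<close>

lemma lborel_distr_swap:
  fixes i j :: "'b::euclidean_space"
  assumes ij: "i \<in> Basis" "j \<in> Basis"
  shows "distr lborel borel (\<lambda>x. x + (x \<bullet> j - x \<bullet> i) *\<^sub>R (i - j)) = lborel"
proof (rule lborel_eqI[symmetric])
  let ?T = "\<lambda>x::'b. x + (x \<bullet> j - x \<bullet> i) *\<^sub>R (i - j)"
  let ?s = "Transposition.transpose i j"
  have T: "?T x \<bullet> b = x \<bullet> ?s b" if "b \<in> Basis" for x b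
    using ij that by (auto simp: inner_simps inner_Basis Transposition.transpose_def)
  have s: "?s b \<in> Basis" if "b \<in> Basis" for b
    using ij that by (auto simp: Transposition.transpose_def)
  have bij: "bij_betw ?s Basis Basis"
    by (rule bij_betwI[of _ _ _ ?s]) (use s in auto)
  fix l u :: 'b assume le: "\<And>b. b \<in> Basis \<Longrightarrow> l \<bullet> b \<le> u \<bullet> b"
  have [measurable]: "?T \<in> borel \<rightarrow>\<^sub>M borel" by simp
  have "?T x \<in> box l u \<longleftrightarrow> x \<in> box (?T l) (?T u)" for x
  proof -
    have "?T x \<in> box l u \<longleftrightarrow> (\<forall>b\<in>Basis. l \<bullet> b < x \<bullet> ?s b \<and> x \<bullet> ?s b < u \<bullet> b)"
      by (simp add: mem_box T)
    also have "\<dots> \<longleftrightarrow> (\<forall>b\<in>Basis. l \<bullet> ?s b < x \<bullet> b \<and> x \<bullet> b < u \<bullet> ?s b)"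
      by (metis s transpose_involutory)
    also have "\<dots> \<longleftrightarrow> x \<in> box (?T l) (?T u)"
      by (simp add: mem_box T)
    finally show ?thesis .
  qed
  then have "?T -` box l u = box (?T l) (?T u)" by auto
  then have "emeasure (distr lborel borel ?T) (box l u) = emeasure lborel (box (?T l) (?T u))"
    by (simp add: emeasure_distr)
  also have "\<dots> = ennreal (\<Prod>b\<in>Basis. (?T u - ?T l) \<bullet> b)"
    unfolding emeasure_lborel_box_eq using le s by (auto simp: T)
  also have "(\<Prod>b\<in>Basis. (?T u - ?T l) \<bullet> b) = (\<Prod>b\<in>Basis. (u - l) \<bullet> ?s b)"
    by (intro prod.cong) (simp_all add: T inner_diff_left)
  also have "\<dots> = (\<Prod>b\<in>Basis. (u - l) \<bullet> b)"
    by (rule prod.reindex_bij_betw[OF bij])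
  finally show "emeasure (distr lborel borel ?T) (box l u) = (\<Prod>b\<in>Basis. (u - l) \<bullet> b)" .
qed simp

lemma integral_lborel_distr:
  fixes g :: "'b::euclidean_space \<Rightarrow> real"
  assumes "distr lborel borel T = (lborel :: 'b measure)" "T \<in> borel \<rightarrow>\<^sub>M borel" "g \<in> borel_measurable borel"
  shows "(\<integral>x. g (T x) \<partial>lborel) = (\<integral>x. g x \<partial>lborel)"
  using integral_distr[of T lborel borel g] assms by simp

text \<open>Reflections and coordinate swaps preserve the norm, hence \<open>J\<close>. Reflecting
  along \<open>b\<close> changes the sign of the first-order and the mixed integrand; swapping
  carries one pure second moment into another. The substitutions are valid for divergent integrals
  too, since both sides then have the default value 0.\<close>

lemma radial_moments:
  fixes J :: "'b::euclidean_space \<Rightarrow> real"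
  assumes J: "J \<in> borel_measurable borel"
    and radial: "\<And>x y. norm x = norm y \<Longrightarrow> J x = J y"
  shows radial_moment1: "b \<in> Basis \<Longrightarrow> (\<integral>z. J z * (z \<bullet> b) \<partial>lborel) = 0"
    and radial_moment2_offdiag: "b \<in> Basis \<Longrightarrow> c \<in> Basis \<Longrightarrow> b \<noteq> c \<Longrightarrow> (\<integral>z. J z * ((z \<bullet> b) * (z \<bullet> c)) \<partial>lborel) = 0"
    and radial_moment2_diag: "b \<in> Basis \<Longrightarrow> c \<in> Basis \<Longrightarrow> (\<integral>z. J z * (z \<bullet> b)\<^sup>2 \<partial>lborel) = (\<integral>z. J z * (z \<bullet> c)\<^sup>2 \<partial>lborel)"
proof -
  note J[measurable]
  let ?R = "\<lambda>b x::'b. x - (2 * (x \<bullet> b)) *\<^sub>R b"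
  have J_R: "J (?R b x) = J x" if "b \<in> Basis" for b x
  proof (rule radial)
    have "(norm (?R b x))\<^sup>2 = (norm x)\<^sup>2"
      using that by (simp add: power2_norm_eq_inner inner_simps inner_Basis algebra_simps inner_commute)
    then show "norm (?R b x) = norm x" by simp
  qed
  { assume b: "b \<in> Basis"
    have "(\<integral>z. J z * (z \<bullet> b) \<partial>lborel) = (\<integral>z. J (?R b z) * (?R b z \<bullet> b) \<partial>lborel)"
      by (rule integral_lborel_distr[OF lborel_distr_reflect[OF b], symmetric]) auto
    also have "\<dots> = (\<integral>z. - (J z * (z \<bullet> b)) \<partial>lborel)"
      using b by (simp add: J_R inner_simps)
    finally show "(\<integral>z. J z * (z \<bullet> b) \<partial>lborel) = 0" by simp }
  { assume b: "b \<in> Basis" "c \<in> Basis" "b \<noteq> c"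
    have "(\<integral>z. J z * ((z \<bullet> b) * (z \<bullet> c)) \<partial>lborel) = (\<integral>z. J (?R b z) * ((?R b z \<bullet> b) * (?R b z \<bullet> c)) \<partial>lborel)"
      by (rule integral_lborel_distr[OF lborel_distr_reflect[OF b(1)], symmetric]) auto
    also have "\<dots> = (\<integral>z. - (J z * ((z \<bullet> b) * (z \<bullet> c))) \<partial>lborel)"
      using b by (simp add: J_R inner_simps inner_Basis)
    finally show "(\<integral>z. J z * ((z \<bullet> b) * (z \<bullet> c)) \<partial>lborel) = 0" by simp }
  { assume b: "b \<in> Basis" "c \<in> Basis"
    let ?T = "\<lambda>x::'b. x + (x \<bullet> c - x \<bullet> b) *\<^sub>R (b - c)"
    have JT: "J (?T x) = J x" for x
    proof (rule radial)
      have "(norm (?T x))\<^sup>2 = (norm x)\<^sup>2"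
        using b by (cases "b = c") (simp_all add: power2_norm_eq_inner inner_simps inner_Basis algebra_simps inner_commute)
      then show "norm (?T x) = norm x" by simp
    qed
    have "(\<integral>z. J z * (z \<bullet> b)\<^sup>2 \<partial>lborel) = (\<integral>z. J (?T z) * (?T z \<bullet> b)\<^sup>2 \<partial>lborel)"
      by (rule integral_lborel_distr[OF lborel_distr_swap[OF b], symmetric]) auto
    also have "\<dots> = (\<integral>z. J z * (z \<bullet> c)\<^sup>2 \<partial>lborel)"
      using b by (cases "b = c") (simp_all add: JT inner_simps inner_Basis)
    finally show "(\<integral>z. J z * (z \<bullet> b)\<^sup>2 \<partial>lborel) = (\<integral>z. J z * (z \<bullet> c)\<^sup>2 \<partial>lborel)" . }
qed

section \<open>Test functions\<close>

lemma C0_inf_continuous: "C0_inf \<Omega> g \<Longrightarrow> continuous_on A g"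
  by (metis C0_inf_def C_k.simps(1) continuous_on_subset subset_UNIV)

lemma C0_inf_differentiable: "C0_inf \<Omega> g \<Longrightarrow> g differentiable at z"
  using C_k.simps(2)[of 0 g] by (auto simp: C0_inf_def)

lemma zero_outside_support:
  fixes g :: "'b::euclidean_space \<Rightarrow> real"
  shows "z \<notin> closure {z. g z \<noteq> 0} \<Longrightarrow> g z = 0"
  using closure_subset[of "{z. g z \<noteq> 0}"] by auto

lemma dir_deriv_zero:
  assumes "z \<notin> closure {z. g z \<noteq> 0}"
  shows "dir_deriv v g z = 0"
proof -
  let ?S = "closure {z. g z \<noteq> 0}"
  have "((\<lambda>_. 0) has_derivative (\<lambda>_. 0)) (at z)" by simp
  then have "(g has_derivative (\<lambda>_. 0)) (at z)"
    by (rule has_derivative_transform_within_open[of _ _ _ _ "- ?S"])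
      (use assms zero_outside_support in \<open>auto simp: open_Compl\<close>)
  then show ?thesis
    unfolding dir_deriv_def by (metis frechet_derivative_at)
qed

text \<open>\<open>C_k\<close> iterates derivatives along basis vectors only, hence the restriction
  on \<open>b\<close>. The support cannot grow, because a derivative vanishes wherever the function
  vanishes nearby.\<close>

lemma C0_inf_dir_deriv:
  assumes g: "C0_inf \<Omega> g" and b: "b \<in> Basis"
  shows "C0_inf \<Omega> (dir_deriv b g)"
proof -
  let ?S = "closure {z. g z \<noteq> 0}"
  have sub: "closure {z. dir_deriv b g z \<noteq> 0} \<subseteq> ?S"
    by (rule closure_minimal) (use dir_deriv_zero[of _ g b] in auto)
  have "C_k n (dir_deriv b g)" for n
    using g b C_k.simps(2)[of n g] by (auto simp: C0_inf_def)
  moreover have "compact (closure {z. dir_deriv b g z \<noteq> 0})"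
    using g sub unfolding C0_inf_def compact_eq_bounded_closed by (blast intro: bounded_subset)
  ultimately show ?thesis using g sub by (auto simp: C0_inf_def)
qed

lemma C0_inf_bounded:
  assumes "C0_inf \<Omega> g"
  obtains C where "0 \<le> C" "\<And>z. \<bar>g z\<bar> \<le> C"
proof -
  let ?S = "closure {z. g z \<noteq> 0}"
  have "compact (g ` ?S)"
    using assms C0_inf_continuous[OF assms, of ?S] by (intro compact_continuous_image) (auto simp: C0_inf_def)
  then obtain C where C: "\<And>z. z \<in> ?S \<Longrightarrow> \<bar>g z\<bar> \<le> C"
    by (metis bounded_iff compact_imp_bounded image_eqI real_norm_def)
  have "\<bar>g z\<bar> \<le> max C 0" for z
    using C[of z] zero_outside_support[of z g] by (cases "z \<in> ?S") auto
  then show ?thesis using that[of "max C 0"] by auto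
qed

section \<open>Taylor expansion in the space variables\<close>

lemma dir_deriv_sum:
  assumes "g differentiable at z"
  shows "dir_deriv v g z = (\<Sum>b\<in>Basis. (v \<bullet> b) * dir_deriv b g z)"
proof -
  interpret linear "frechet_derivative g (at z)"
    using assms by (rule linear_frechet_derivative)
  have "frechet_derivative g (at z) (\<Sum>b\<in>Basis. (v \<bullet> b) *\<^sub>R b) = (\<Sum>b\<in>Basis. (v \<bullet> b) * frechet_derivative g (at z) b)"
    by (simp add: sum scale)
  then show ?thesis by (simp add: dir_deriv_def euclidean_representation)
qed

lemma has_real_derivative_line:
  fixes g :: "'b::euclidean_space \<Rightarrow> real"
  assumes "g differentiable at (x + s *\<^sub>R v)"
  shows "((\<lambda>s. g (x + s *\<^sub>R v)) has_real_derivative dir_deriv v g (x + s *\<^sub>R v)) (at s)"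
proof -
  let ?D = "frechet_derivative g (at (x + s *\<^sub>R v))"
  have "(g has_derivative ?D) (at (x + s *\<^sub>R v))"
    using assms by (simp add: frechet_derivative_works)
  moreover have "((\<lambda>s. x + s *\<^sub>R v) has_derivative (\<lambda>h. h *\<^sub>R v)) (at s)"
    by (auto intro!: derivative_eq_intros)
  ultimately have "((\<lambda>s. g (x + s *\<^sub>R v)) has_derivative (\<lambda>h. ?D (h *\<^sub>R v))) (at s)"
    by (rule has_derivative_compose[rotated])
  moreover interpret linear ?D
    using assms by (rule linear_frechet_derivative)
  have "(\<lambda>h. ?D (h *\<^sub>R v)) = (\<lambda>h. h * dir_deriv v g (x + s *\<^sub>R v))"
    by (simp add: scale dir_deriv_def)
  ultimately show ?thesis
    by (simp add: has_field_derivative_def mult_commute_abs)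
qed

text \<open>A direction \<open>(z, 0)\<close> is orthogonal to every basis vector of the second
  factor, so only derivatives in the first factor survive.\<close>

lemma sum_Basis_prod_fst:
  fixes z :: "'a::euclidean_space" and F :: "'a \<times> 'b::euclidean_space \<Rightarrow> real"
  shows "(\<Sum>b\<in>Basis. ((z, 0) \<bullet> b) * F b) = (\<Sum>b\<in>Basis. (z \<bullet> b) * F (b, 0))"
proof -
  have "(\<lambda>u::'a. (u, 0::'b)) ` Basis \<inter> (\<lambda>u. (0, u)) ` Basis = {}" by (auto simp: nonzero_Basis)
  then show ?thesis
    unfolding Basis_prod_def
    by (subst sum.union_disjoint) (auto simp: sum.reindex inj_on_def)
qed

text \<open>This is the Maclaurin formula with Lagrange remainder for the restriction of
  \<open>\<phi>\<close> to the line through \<open>(x, t)\<close> with direction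
  \<open>(z, 0)\<close>. The intermediate point depends on all the data, which is harmless because
  the second derivatives are bounded and continuous.\<close>

lemma space_taylor:
  fixes \<phi> :: "'a::euclidean_space \<times> real \<Rightarrow> real"
  assumes \<phi>: "C0_inf \<Omega> \<phi>"
  shows "\<exists>s. \<bar>s\<bar> \<le> \<bar>h\<bar> \<and> \<phi> (x + h *\<^sub>R z, t) = \<phi> (x, t) + h * (\<Sum>b\<in>Basis. (z \<bullet> b) * dir_deriv (b, 0) \<phi> (x, t))
     + h\<^sup>2 / 2 * (\<Sum>b\<in>Basis. \<Sum>c\<in>Basis. ((z \<bullet> b) * (z \<bullet> c)) * dir_deriv (c, 0) (dir_deriv (b, 0) \<phi>) (x + s *\<^sub>R z, t))"
proof -
  let ?D = "\<lambda>b. dir_deriv (b, 0 :: real)"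
  let ?d0 = "\<lambda>s. \<phi> (x + s *\<^sub>R z, t)"
  let ?d1 = "\<lambda>s. \<Sum>b\<in>Basis. (z \<bullet> b) * ?D b \<phi> (x + s *\<^sub>R z, t)"
  let ?d2 = "\<lambda>s. \<Sum>b\<in>Basis. \<Sum>c\<in>Basis. ((z \<bullet> b) * (z \<bullet> c)) * ?D c (?D b \<phi>) (x + s *\<^sub>R z, t)"
  have line: "((\<lambda>s. g (x + s *\<^sub>R z, t)) has_real_derivative (\<Sum>b\<in>Basis. (z \<bullet> b) * ?D b g (x + s *\<^sub>R z, t))) (at s)"
    if "C0_inf \<Omega> g" for g s
    using has_real_derivative_line[where g = g and x = "(x, t)" and s = s and v = "(z, 0)"] C0_inf_differentiable[OF that]
    by (simp add: dir_deriv_sum[OF C0_inf_differentiable[OF that], where v = "(z, 0)"] sum_Basis_prod_fst)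
  have d1: "(?d0 has_real_derivative ?d1 s) (at s)" for s
    by (rule line[OF \<phi>])
  have d2: "(?d1 has_real_derivative ?d2 s) (at s)" for s
    \<comment> \<open>The double sum is regrouped as a sum over \<open>b\<close> of
      \<open>z \<bullet> b\<close> times the derivative of \<open>dir_deriv (b, 0) \<phi>\<close>
      along the line, so that \<open>line\<close> applies to each summand.\<close>
    unfolding sum_distrib_left mult.assoc
    unfolding sum_distrib_left[symmetric]
    by (intro DERIV_sum DERIV_cmult line C0_inf_dir_deriv[OF \<phi>]) (simp add: Basis_prod_def)
  let ?diff = "\<lambda>m. if m = 0 then ?d0 else if m = Suc 0 then ?d1 else ?d2"
  have "\<exists>s. \<bar>s\<bar> \<le> \<bar>h\<bar> \<and> ?d0 h = (\<Sum>m<2. (?diff m 0 / fact m) * h ^ m) + (?diff 2 s / fact 2) * h ^ 2"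
    by (rule Maclaurin_bi_le) (use d1 d2 in \<open>auto simp: less_2_cases_iff\<close>)
  then show ?thesis
    by (simp add: numeral_2_eq_2 mult.commute cong: sum.cong)
qed

lemma C0_inf_borel_measurable: "C0_inf \<Omega> g \<Longrightarrow> g \<in> borel_measurable borel"
  by (intro borel_measurable_continuous_onI C0_inf_continuous)

text \<open>The factor \<open>q\<close> may be unbounded, since only its values on the compact
  support of \<open>g\<close> count. With polynomial \<open>q\<close> this covers all moments of
  \<open>J\<close>.\<close>

lemma C0_inf_mult_integrable:
  fixes g q :: "'b::euclidean_space \<Rightarrow> real"
  assumes g: "C0_inf \<Omega> g" and q: "continuous_on UNIV q"
  shows "integrable lborel (\<lambda>z. g z * q z)"
proof -
  let ?S = "closure {z. g z \<noteq> 0}"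
  have S: "compact ?S" using g by (simp add: C0_inf_def)
  have cont: "continuous_on UNIV (\<lambda>z. g z * q z)"
    by (intro continuous_intros C0_inf_continuous[OF g] q)
  have "compact ((\<lambda>z. g z * q z) ` ?S)"
    using S by (intro compact_continuous_image continuous_on_subset[OF cont]) auto
  then obtain M where "\<forall>w\<in>(\<lambda>z. g z * q z) ` ?S. norm w \<le> M"
    using compact_imp_bounded bounded_iff by blast
  then have M: "\<bar>g z * q z\<bar> \<le> M" if "z \<in> ?S" for z
    using that by simp
  show ?thesis
  proof (rule integrable_bounded_support)
    show "(\<lambda>z. g z * q z) \<in> borel_measurable borel"
      by (intro borel_measurable_continuous_onI cont)
    show "\<bar>g z * q z\<bar> \<le> max M 0" for z
      using M[of z] zero_outside_support[of z g] by (cases "z \<in> ?S") auto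
    show "bounded ?S" using S by (rule compact_imp_bounded)
    show "g z * q z = 0" if "z \<notin> ?S" for z
      using zero_outside_support[OF that] by simp
  qed
qed

section \<open>The nonlocal operator and its diffusive limit\<close>

text \<open>The parameter \<open>h\<close> is signed: the operator with kernel
  \<open>J (x - y)\<close> is the case \<open>h = - 1\<close>, and passing to the adjoint reverses
  the sign. Integration is over \<open>lborel\<close> to stay with Borel functions, as Fubini
  requires.\<close>

definition nonlocal_op :: "('a::euclidean_space \<Rightarrow> real) \<Rightarrow> real \<Rightarrow> ('a \<times> real \<Rightarrow> real) \<Rightarrow> 'a \<times> real \<Rightarrow> real" where
  "nonlocal_op J h g z = (\<integral>y. J y * (g (z + h *\<^sub>R (y, 0)) - g z) \<partial>lborel)"

text \<open>A radial \<open>J\<close> has no first moments, so the first-order term can be subtracted under the integral.\<close>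

definition taylor_remainder :: "('a::euclidean_space \<times> real \<Rightarrow> real) \<Rightarrow> 'a \<times> real \<Rightarrow> real \<Rightarrow> 'a \<Rightarrow> real" where
  "taylor_remainder g z h y = g (z + h *\<^sub>R (y, 0)) - g z - h * (\<Sum>b\<in>Basis. (y \<bullet> b) * dir_deriv (b, 0) g z)"

lemma taylor_remainder_continuous:
  assumes "C0_inf \<Omega> g"
  shows "continuous_on UNIV (taylor_remainder g z h)"
  unfolding taylor_remainder_def
  by (intro continuous_intros continuous_on_compose2[OF C0_inf_continuous[OF assms, of UNIV]]) auto

lemma nonlocal_op_eq_remainder:
  fixes J :: "'a::euclidean_space \<Rightarrow> real"
  assumes J: "C0_inf UNIV J" and radial: "\<And>x y. norm x = norm y \<Longrightarrow> J x = J y"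
    and g: "C0_inf \<Omega> g"
  shows "nonlocal_op J h g z = (\<integral>y. J y * taylor_remainder g z h y \<partial>lborel)"
proof -
  have 1: "integrable lborel (\<lambda>y. J y * taylor_remainder g z h y)"
    by (intro C0_inf_mult_integrable[OF J] taylor_remainder_continuous[OF g])
  have 2: "integrable lborel (\<lambda>y. J y * (y \<bullet> b) * (h * dir_deriv (b, 0) g z))" for b
    by (intro integrable_mult_left C0_inf_mult_integrable[OF J] continuous_intros)
  have "nonlocal_op J h g z = (\<integral>y. J y * taylor_remainder g z h y + (\<Sum>b\<in>Basis. J y * (y \<bullet> b) * (h * dir_deriv (b, 0) g z)) \<partial>lborel)"
    unfolding nonlocal_op_def taylor_remainder_def
    by (intro Bochner_Integration.integral_cong refl) (simp add: algebra_simps sum_distrib_left)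
  also have "\<dots> = (\<integral>y. J y * taylor_remainder g z h y \<partial>lborel) + (\<Sum>b\<in>Basis. (\<integral>y. J y * (y \<bullet> b) \<partial>lborel) * (h * dir_deriv (b, 0) g z))"
    using 1 2 by (simp add: Bochner_Integration.integral_add Bochner_Integration.integral_sum Bochner_Integration.integrable_sum)
  also have "(\<Sum>b\<in>Basis. (\<integral>y. J y * (y \<bullet> b) \<partial>lborel) * (h * dir_deriv (b, 0) g z)) = 0"
    using radial_moment1[OF C0_inf_borel_measurable[OF J] radial] by (intro sum.neutral) simp
  finally show ?thesis by simp
qed

lemma taylor_remainder_eq:
  assumes "C0_inf \<Omega> g"
  shows "\<exists>s. \<bar>s\<bar> \<le> \<bar>h\<bar> \<and> taylor_remainder g z h y =
    h\<^sup>2 / 2 * (\<Sum>b\<in>Basis. \<Sum>c\<in>Basis. ((y \<bullet> b) * (y \<bullet> c)) * dir_deriv (c, 0) (dir_deriv (b, 0) g) (z + s *\<^sub>R (y, 0)))"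
proof -
  obtain x t where z: "z = (x, t)" by fastforce
  show ?thesis using space_taylor[OF assms, of h x y t] by (force simp: z taylor_remainder_def)
qed

lemma C0_inf_second_deriv:
  assumes "C0_inf \<Omega> g" "b \<in> Basis" "c \<in> Basis"
  shows "C0_inf \<Omega> (dir_deriv (c, 0) (dir_deriv (b, 0) g))"
  using assms by (intro C0_inf_dir_deriv) (auto simp: Basis_prod_def)

text \<open>Second derivatives of a smooth function with compact support are bounded on the whole
  space, and each coordinate of \<open>y\<close> is at most \<open>norm y\<close>; so one constant
  serves every base point and every \<open>h\<close>.\<close>

lemma taylor_remainder_bound:
  fixes g :: "'a::euclidean_space \<times> real \<Rightarrow> real"
  assumes g: "C0_inf \<Omega> g"
  obtains M where "0 \<le> M" "\<And>z h y. \<bar>taylor_remainder g z h y\<bar> \<le> h\<^sup>2 * (M * (norm y)\<^sup>2)"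
proof -
  let ?D = "\<lambda>b c. dir_deriv (c, 0) (dir_deriv (b, 0) g)"
  have "\<exists>C\<ge>0. \<forall>z. \<bar>?D b c z\<bar> \<le> C" if "b \<in> Basis" "c \<in> Basis" for b c
    using C0_inf_bounded[OF C0_inf_second_deriv[OF g that]] by metis
  then obtain C where C: "\<And>b c. b \<in> Basis \<Longrightarrow> c \<in> Basis \<Longrightarrow> 0 \<le> C b c"
      "\<And>b c z. b \<in> Basis \<Longrightarrow> c \<in> Basis \<Longrightarrow> \<bar>?D b c z\<bar> \<le> C b c" by metis
  \<comment> \<open>The division by 2 is the factor of the second-order Taylor term.\<close>
  let ?M = "(\<Sum>b\<in>Basis. \<Sum>c\<in>Basis. C b c) / 2"
  show ?thesis
  proof (rule that)
    show "0 \<le> ?M" using C(1) by (auto intro!: sum_nonneg)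
    fix z h y
    obtain s where s: "taylor_remainder g z h y =
        h\<^sup>2 / 2 * (\<Sum>b\<in>Basis. \<Sum>c\<in>Basis. ((y \<bullet> b) * (y \<bullet> c)) * ?D b c (z + s *\<^sub>R (y, 0)))"
      using taylor_remainder_eq[OF g] by blast
    have "\<bar>\<Sum>b\<in>Basis. \<Sum>c\<in>Basis. ((y \<bullet> b) * (y \<bullet> c)) * ?D b c (z + s *\<^sub>R (y, 0))\<bar>
       \<le> (\<Sum>b\<in>Basis. \<Sum>c\<in>Basis. (norm y)\<^sup>2 * C b c)"
    proof (intro order_trans[OF sum_abs] sum_mono)
      fix b c :: 'a assume bc: "b \<in> Basis" "c \<in> Basis"
      have "\<bar>y \<bullet> b\<bar> * \<bar>y \<bullet> c\<bar> * \<bar>?D b c (z + s *\<^sub>R (y, 0))\<bar> \<le> norm y * norm y * C b c"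
        using bc C by (intro mult_mono Basis_le_norm) auto
      then show "\<bar>(y \<bullet> b) * (y \<bullet> c) * ?D b c (z + s *\<^sub>R (y, 0))\<bar> \<le> (norm y)\<^sup>2 * C b c"
        by (simp add: abs_mult power2_eq_square)
    qed
    also have "\<dots> = 2 * (?M * (norm y)\<^sup>2)"
      by (simp add: sum_distrib_left[symmetric])
    finally have "\<bar>h\<^sup>2 / 2\<bar> * \<bar>\<Sum>b\<in>Basis. \<Sum>c\<in>Basis. ((y \<bullet> b) * (y \<bullet> c)) * ?D b c (z + s *\<^sub>R (y, 0))\<bar> \<le> \<bar>h\<^sup>2 / 2\<bar> * (2 * (?M * (norm y)\<^sup>2))"
      by (intro mult_left_mono) auto
    then show "\<bar>taylor_remainder g z h y\<bar> \<le> h\<^sup>2 * (?M * (norm y)\<^sup>2)"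
      unfolding s abs_mult by simp
  qed
qed

text \<open>The quadratic order comes from replacing the increment by the Taylor remainder. Divided
  by \<open>h\<^sup>2\<close>, this is the uniform bound on the test factor that dominated
  convergence in space-time will use.\<close>

lemma nonlocal_op_bound:
  fixes J :: "'a::euclidean_space \<Rightarrow> real"
  assumes J: "C0_inf UNIV J" and radial: "\<And>x y. norm x = norm y \<Longrightarrow> J x = J y"
    and g: "C0_inf \<Omega> g"
  obtains C where "\<And>h z. \<bar>nonlocal_op J h g z\<bar> \<le> C * h\<^sup>2"
proof -
  obtain M where M: "0 \<le> M" "\<And>z h y. \<bar>taylor_remainder g z h y\<bar> \<le> h\<^sup>2 * (M * (norm y)\<^sup>2)"
    using taylor_remainder_bound[OF g] by blast
  have int: "integrable lborel (\<lambda>y. J y * (norm y)\<^sup>2)"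
    by (intro C0_inf_mult_integrable[OF J] continuous_intros)
  have "\<bar>nonlocal_op J h g z\<bar> \<le> ((\<integral>y. \<bar>J y * (norm y)\<^sup>2\<bar> \<partial>lborel) * M) * h\<^sup>2" for h z
  proof -
    have "\<bar>nonlocal_op J h g z\<bar> \<le> (\<integral>y. \<bar>J y * taylor_remainder g z h y\<bar> \<partial>lborel)"
      using integral_norm_bound[of lborel "\<lambda>y. J y * taylor_remainder g z h y"]
      by (simp add: nonlocal_op_eq_remainder[OF J radial g])
    also have "\<dots> \<le> (\<integral>y. \<bar>J y * (norm y)\<^sup>2\<bar> * (M * h\<^sup>2) \<partial>lborel)"
    proof (rule integral_mono)
      show "integrable lborel (\<lambda>y. \<bar>J y * taylor_remainder g z h y\<bar>)"
        by (intro integrable_abs C0_inf_mult_integrable[OF J] taylor_remainder_continuous[OF g])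
      show "integrable lborel (\<lambda>y. \<bar>J y * (norm y)\<^sup>2\<bar> * (M * h\<^sup>2))"
        by (intro integrable_mult_left integrable_abs int)
      fix y
      have "\<bar>J y\<bar> * \<bar>taylor_remainder g z h y\<bar> \<le> \<bar>J y\<bar> * (h\<^sup>2 * (M * (norm y)\<^sup>2))"
        by (intro mult_left_mono M) auto
      then show "\<bar>J y * taylor_remainder g z h y\<bar> \<le> \<bar>J y * (norm y)\<^sup>2\<bar> * (M * h\<^sup>2)"
        by (simp add: abs_mult mult_ac)
    qed
    also have "\<dots> = ((\<integral>y. \<bar>J y * (norm y)\<^sup>2\<bar> \<partial>lborel) * M) * h\<^sup>2"
      by simp
    finally show ?thesis .
  qed
  then show ?thesis by (rule that)
qed

text \<open>All pure second moments coincide, and they add up to the integral of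
  \<open>J y * (norm y)\<^sup>2\<close>. This is the origin of the factor \<open>2 * DIM('a)\<close>
  in \<open>diffusion_coeff\<close>.\<close>

lemma radial_second_moment:
  fixes J :: "'a::euclidean_space \<Rightarrow> real"
  assumes J: "C0_inf UNIV J" and radial: "\<And>x y. norm x = norm y \<Longrightarrow> J x = J y"
    and b: "b \<in> Basis"
  shows "(\<integral>y. J y * (y \<bullet> b)\<^sup>2 \<partial>lborel) = 2 * diffusion_coeff J"
proof -
  note m = radial_moment2_diag[OF C0_inf_borel_measurable[OF J] radial]
  have [measurable]: "J \<in> borel_measurable borel" by (rule C0_inf_borel_measurable[OF J])
  have int: "integrable lborel (\<lambda>y. J y * (y \<bullet> c)\<^sup>2)" for c
    by (intro C0_inf_mult_integrable[OF J] continuous_intros)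
  have "(\<integral>y. J y * (norm y)\<^sup>2 \<partial>lebesgue) = (\<integral>y. J y * (norm y)\<^sup>2 \<partial>lborel)"
    by (rule integral_completion) measurable
  also have "\<dots> = (\<integral>y. (\<Sum>c\<in>Basis. J y * (y \<bullet> c)\<^sup>2) \<partial>lborel)"
  proof (intro Bochner_Integration.integral_cong refl)
    fix y :: 'a
    have "(norm y)\<^sup>2 = (\<Sum>c\<in>Basis. (y \<bullet> c)\<^sup>2)"
      by (subst power2_norm_eq_inner, subst euclidean_inner) (simp add: power2_eq_square)
    then show "J y * (norm y)\<^sup>2 = (\<Sum>c\<in>Basis. J y * (y \<bullet> c)\<^sup>2)"
      by (simp add: sum_distrib_left)
  qed
  also have "\<dots> = (\<Sum>c\<in>Basis. (\<integral>y. J y * (y \<bullet> c)\<^sup>2 \<partial>lborel))"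
    using int by (rule Bochner_Integration.integral_sum)
  also have "\<dots> = (\<Sum>c\<in>(Basis :: 'a set). (\<integral>y. J y * (y \<bullet> b)\<^sup>2 \<partial>lborel))"
    by (intro sum.cong refl m b)
  finally show ?thesis by (simp add: diffusion_coeff_def)
qed

text \<open>Dominated convergence in \<open>y\<close>: the quotients are at most
  \<open>M * (norm y)\<^sup>2\<close>, which is integrable against \<open>J\<close>, and they
  converge because the intermediate points of Taylor's formula tend to \<open>z\<close>. In the
  limiting quadratic form only diagonal terms survive; each has weight one half of
  \<open>2 * diffusion_coeff J\<close>.\<close>

lemma nonlocal_op_tendsto:
  fixes J :: "'a::euclidean_space \<Rightarrow> real"
  assumes J: "C0_inf UNIV J" and radial: "\<And>x y. norm x = norm y \<Longrightarrow> J x = J y"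
    and g: "C0_inf \<Omega> g" and h: "h \<longlonglongrightarrow> 0" "\<And>n. h n \<noteq> 0"
  shows "(\<lambda>n. nonlocal_op J (h n) g z / (h n)\<^sup>2) \<longlonglongrightarrow> diffusion_coeff J * space_laplacian g z"
proof -
  let ?D = "\<lambda>b c. dir_deriv (c, 0) (dir_deriv (b, 0) g)"
  let ?Q = "\<lambda>y w. (\<Sum>b\<in>Basis. \<Sum>c\<in>Basis. ((y \<bullet> b) * (y \<bullet> c)) * ?D b c w)"
  have [measurable]: "J \<in> borel_measurable borel" by (rule C0_inf_borel_measurable[OF J])
  have [measurable]: "taylor_remainder g z k \<in> borel_measurable borel" for k
    by (intro borel_measurable_continuous_onI taylor_remainder_continuous[OF g])
  obtain M where M: "0 \<le> M" "\<And>z h y. \<bar>taylor_remainder g z h y\<bar> \<le> h\<^sup>2 * (M * (norm y)\<^sup>2)"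
    using taylor_remainder_bound[OF g] by blast
  have "(\<lambda>n. \<integral>y. J y * taylor_remainder g z (h n) y / (h n)\<^sup>2 \<partial>lborel) \<longlonglongrightarrow> (\<integral>y. J y * (?Q y z / 2) \<partial>lborel)"
  proof (rule integral_dominated_convergence)
    show "integrable lborel (\<lambda>y. \<bar>J y * (M * (norm y)\<^sup>2)\<bar>)"
      by (intro integrable_abs C0_inf_mult_integrable[OF J] continuous_intros)
    show "AE y in lborel. norm (J y * taylor_remainder g z (h n) y / (h n)\<^sup>2) \<le> \<bar>J y * (M * (norm y)\<^sup>2)\<bar>" for n
    proof (intro AE_I2)
      fix y
      have "\<bar>J y\<bar> * (\<bar>taylor_remainder g z (h n) y\<bar> / (h n)\<^sup>2) \<le> \<bar>J y\<bar> * (M * (norm y)\<^sup>2)"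
        using M(2)[of z "h n" y] h(2)[of n] by (intro mult_left_mono) (auto simp: divide_le_eq mult.commute)
      then show "norm (J y * taylor_remainder g z (h n) y / (h n)\<^sup>2) \<le> \<bar>J y * (M * (norm y)\<^sup>2)\<bar>"
        using M(1) by (simp add: abs_mult)
    qed
    show "AE y in lborel. (\<lambda>n. J y * taylor_remainder g z (h n) y / (h n)\<^sup>2) \<longlonglongrightarrow> J y * (?Q y z / 2)"
    proof (intro AE_I2)
      fix y
      have "\<forall>n. \<exists>s. \<bar>s\<bar> \<le> \<bar>h n\<bar> \<and> taylor_remainder g z (h n) y = (h n)\<^sup>2 / 2 * ?Q y (z + s *\<^sub>R (y, 0))"
        by (intro allI taylor_remainder_eq[OF g])
      from choice[OF this] obtain s where s: "\<And>n. \<bar>s n\<bar> \<le> \<bar>h n\<bar>" "\<And>n. taylor_remainder g z (h n) y = (h n)\<^sup>2 / 2 * ?Q y (z + s n *\<^sub>R (y, 0))"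
        by blast
      have "s \<longlonglongrightarrow> 0"
        by (rule Lim_null_comparison[OF _ tendsto_rabs_zero[OF h(1)]]) (use s(1) in simp)
      then have "(\<lambda>n. z + s n *\<^sub>R (y, 0)) \<longlonglongrightarrow> z + 0 *\<^sub>R (y, 0)"
        by (intro tendsto_intros)
      then have lim: "(\<lambda>n. z + s n *\<^sub>R (y, 0)) \<longlonglongrightarrow> z"
        by (simp add: zero_prod_def[symmetric])
      have "(\<lambda>n. ?D b c (z + s n *\<^sub>R (y, 0))) \<longlonglongrightarrow> ?D b c z" if "b \<in> Basis" "c \<in> Basis" for b c
        using continuous_on_tendsto_compose[OF C0_inf_continuous[OF C0_inf_second_deriv[OF g that], of UNIV] lim] by simp
      then have "(\<lambda>n. J y * (?Q y (z + s n *\<^sub>R (y, 0)) / 2)) \<longlonglongrightarrow> J y * (?Q y z / 2)"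
        by (intro tendsto_intros) auto
      moreover have "J y * taylor_remainder g z (h n) y / (h n)\<^sup>2 = J y * (?Q y (z + s n *\<^sub>R (y, 0)) / 2)" for n
        using h(2)[of n] by (simp add: s(2))
      ultimately show "(\<lambda>n. J y * taylor_remainder g z (h n) y / (h n)\<^sup>2) \<longlonglongrightarrow> J y * (?Q y z / 2)"
        by (simp only:)
    qed
  qed measurable
  also have "(\<lambda>n. \<integral>y. J y * taylor_remainder g z (h n) y / (h n)\<^sup>2 \<partial>lborel) = (\<lambda>n. nonlocal_op J (h n) g z / (h n)\<^sup>2)"
    by (simp add: nonlocal_op_eq_remainder[OF J radial g])
  also have "(\<integral>y. J y * (?Q y z / 2) \<partial>lborel) = diffusion_coeff J * space_laplacian g z"
  proof -
    have int: "integrable lborel (\<lambda>y. J y * ((y \<bullet> b) * (y \<bullet> c)) * (?D b c z / 2))" for b c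
      by (intro integrable_mult_left C0_inf_mult_integrable[OF J] continuous_intros)
    have "(\<integral>y. J y * (?Q y z / 2) \<partial>lborel) = (\<integral>y. (\<Sum>b\<in>Basis. \<Sum>c\<in>Basis. J y * ((y \<bullet> b) * (y \<bullet> c)) * (?D b c z / 2)) \<partial>lborel)"
      by (simp add: sum_distrib_left sum_divide_distrib mult_ac)
    also have "\<dots> = (\<Sum>b\<in>Basis. \<Sum>c\<in>Basis. (\<integral>y. J y * ((y \<bullet> b) * (y \<bullet> c)) \<partial>lborel) * (?D b c z / 2))"
      using int by (simp add: Bochner_Integration.integral_sum Bochner_Integration.integrable_sum)
    also have "\<dots> = (\<Sum>b\<in>Basis. diffusion_coeff J * ?D b b z)"
    proof (intro sum.cong refl)
      fix b :: 'a assume b: "b \<in> Basis"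
      have "(\<integral>y. J y * ((y \<bullet> b) * (y \<bullet> c)) \<partial>lborel) = (if c = b then 2 * diffusion_coeff J else 0)" if "c \<in> Basis" for c
        using radial_second_moment[OF J radial b] radial_moment2_offdiag[OF C0_inf_borel_measurable[OF J] radial b that]
        by (auto simp: power2_eq_square)
      then have "(\<Sum>c\<in>Basis. (\<integral>y. J y * ((y \<bullet> b) * (y \<bullet> c)) \<partial>lborel) * (?D b c z / 2))
          = (\<Sum>c\<in>Basis. if c = b then diffusion_coeff J * ?D b c z else 0)"
        by (intro sum.cong) auto
      then show "(\<Sum>c\<in>Basis. (\<integral>y. J y * ((y \<bullet> b) * (y \<bullet> c)) \<partial>lborel) * (?D b c z / 2)) = diffusion_coeff J * ?D b b z"
        using b by simp
    qed
    finally show ?thesis by (simp add: space_laplacian_def sum_distrib_left)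
  qed
  finally show ?thesis .
qed

lemma nonlocal_op_measurable:
  assumes [measurable]: "J \<in> borel_measurable borel" "w \<in> borel_measurable borel"
  shows "nonlocal_op J h w \<in> borel_measurable borel"
proof -
  have "(\<lambda>z. \<integral>y. J y * (w (z + h *\<^sub>R (y, 0)) - w z) \<partial>lborel) \<in> borel_measurable borel"
    by (rule lborel.borel_measurable_lebesgue_integral) measurable
  then show ?thesis by (simp add: nonlocal_op_def[abs_def])
qed

text \<open>Two values between 0 and \<open>M\<close> differ by at most \<open>M\<close>. This crude
  bound is meant for the solution, which is merely measurable in space, at a fixed scale.\<close>

lemma nonlocal_op_bounded:
  assumes J: "integrable lborel J" and w: "w \<in> borel_measurable borel" "\<And>z. 0 \<le> w z" "\<And>z. w z \<le> M"
  shows "\<bar>nonlocal_op J h w z\<bar> \<le> (\<integral>y. \<bar>J y\<bar> * M \<partial>lborel)"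
proof -
  have [measurable]: "J \<in> borel_measurable borel" using borel_measurable_integrable[OF J] by simp
  note w(1)[measurable]
  have le: "\<bar>J y * (w (z + h *\<^sub>R (y, 0)) - w z)\<bar> \<le> \<bar>J y\<bar> * M" for y
    using w(2,3)[of z] w(2,3)[of "z + h *\<^sub>R (y, 0)"]
    unfolding abs_mult by (intro mult_left_mono) auto
  have int: "integrable lborel (\<lambda>y. \<bar>J y\<bar> * M)"
    using J by simp
  have "\<bar>nonlocal_op J h w z\<bar> \<le> (\<integral>y. \<bar>J y * (w (z + h *\<^sub>R (y, 0)) - w z)\<bar> \<partial>lborel)"
    unfolding nonlocal_op_def
    using integral_norm_bound[of lborel "\<lambda>y. J y * (w (z + h *\<^sub>R (y, 0)) - w z)"] by simp
  also have "\<dots> \<le> (\<integral>y. \<bar>J y\<bar> * M \<partial>lborel)"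
  proof (rule integral_mono)
    show "integrable lborel (\<lambda>y. \<bar>J y * (w (z + h *\<^sub>R (y, 0)) - w z)\<bar>)"
    proof (rule Bochner_Integration.integrable_bound[OF int])
      show "AE y in lborel. norm \<bar>J y * (w (z + h *\<^sub>R (y, 0)) - w z)\<bar> \<le> norm (\<bar>J y\<bar> * M)"
        using le by (intro AE_I2) (metis abs_ge_self abs_idempotent order_trans real_norm_def)
    qed measurable
  qed (use int le in auto)
  finally show ?thesis .
qed

section \<open>The weak form of the nonlocal equation\<close>

text \<open>The least time in a nonempty compact subset is attained and hence positive. Halving it
  and adding 1 to the largest time makes both bounds strict.\<close>

lemma compact_spacetime_time_bounds:
  assumes "compact S" "S \<subseteq> spacetime"
  obtains a b where "0 < a" "a < b" "\<And>x t. (x, t) \<in> S \<Longrightarrow> a < t \<and> t < b"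
proof (cases "S = {}")
  case True
  then show ?thesis using that[of 1 2] by auto
next
  case False
  have c: "compact (snd ` S)" using assms(1) by (intro compact_continuous_image continuous_intros)
  obtain z where z: "z \<in> S" "\<And>y. y \<in> S \<Longrightarrow> snd z \<le> snd y"
    using compact_attains_inf[OF c] False by auto
  obtain z' where z': "z' \<in> S" "\<And>y. y \<in> S \<Longrightarrow> snd y \<le> snd z'"
    using compact_attains_sup[OF c] False by auto
  have "snd z > 0" using assms(2) z(1) by (auto simp: spacetime_def)
  then show ?thesis
    using z(2) z' z(2)[OF z'(1)] by (intro that[of "snd z / 2" "snd z' + 1"]) fastforce+
qed

text \<open>\<open>G\<close> need not be continuous in time: the Henstock-Kurzweil fundamental theorem of calculus
  integrates any derivative.\<close>

lemma time_deriv_weak: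
  fixes w G \<phi> :: "'a::euclidean_space \<times> real \<Rightarrow> real"
  assumes \<phi>: "C0_inf spacetime \<phi>"
    and w: "w \<in> borel_measurable borel" "\<And>z. \<bar>w z\<bar> \<le> M"
    and G: "G \<in> borel_measurable borel" "\<And>z. \<bar>G z\<bar> \<le> C"
    and N: "N \<in> null_sets lborel"
    and ode: "\<And>x t. x \<notin> N \<Longrightarrow> 0 < t \<Longrightarrow> ((\<lambda>s. w (x, s)) has_real_derivative G (x, t)) (at t)"
  shows "(\<integral>z. G z * \<phi> z \<partial>lborel) + (\<integral>z. w z * time_deriv \<phi> z \<partial>lborel) = 0"
proof -
  define S where "S = closure {z. \<phi> z \<noteq> 0}"
  have S: "compact S" "S \<subseteq> spacetime" using \<phi> by (auto simp: C0_inf_def S_def)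
  note bS = compact_imp_bounded[OF S(1)]
  have \<phi>': "C0_inf spacetime (time_deriv \<phi>)"
    unfolding time_deriv_def by (intro C0_inf_dir_deriv[OF \<phi>]) (simp add: Basis_prod_def)
  note [measurable] = w(1) G(1) C0_inf_borel_measurable[OF \<phi>] C0_inf_borel_measurable[OF \<phi>']
  obtain A where A: "0 \<le> A" "\<And>z. \<bar>\<phi> z\<bar> \<le> A" using C0_inf_bounded[OF \<phi>] by blast
  obtain A' where A': "0 \<le> A'" "\<And>z. \<bar>time_deriv \<phi> z\<bar> \<le> A'" using C0_inf_bounded[OF \<phi>'] by blast
  have out: "\<phi> z = 0" "time_deriv \<phi> z = 0" if "z \<notin> S" for z
    unfolding time_deriv_def by (rule zero_outside_support[OF that[unfolded S_def]], rule dir_deriv_zero[OF that[unfolded S_def]])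
  have C: "0 \<le> C" "0 \<le> M" using G(2) w(2) by (meson abs_ge_zero order_trans)+
  have b1: "\<bar>G z * \<phi> z\<bar> \<le> C * A" for z
    unfolding abs_mult using C A G(2) by (intro mult_mono) auto
  have b2: "\<bar>w z * time_deriv \<phi> z\<bar> \<le> M * A'" for z
    unfolding abs_mult using C A' w(2) by (intro mult_mono) auto
  have int1: "integrable lborel (\<lambda>z. G z * \<phi> z)"
    by (rule integrable_bounded_support[OF _ b1 bS]) (use out in simp_all)
  have int2: "integrable lborel (\<lambda>z. w z * time_deriv \<phi> z)"
    by (rule integrable_bounded_support[OF _ b2 bS]) (use out in simp_all)
  let ?H = "\<lambda>z. G z * \<phi> z + w z * time_deriv \<phi> z"
  have int: "integrable lborel ?H" using int1 int2 by simp
  obtain a b where ab: "0 < a" "a < b" "\<And>x t. (x, t) \<in> S \<Longrightarrow> a < t \<and> t < b"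
    using compact_spacetime_time_bounds[OF S] by blast
  \<comment> \<open>For fixed \<open>x\<close> the integrand is the time derivative of the product
    of \<open>w\<close> and \<open>\<phi>\<close>, and \<open>\<phi>\<close> vanishes at the end
    times \<open>a\<close> and \<open>b\<close>.\<close>
  have zero: "(\<integral>t. ?H (x, t) \<partial>lborel) = 0" if x: "x \<notin> N" for x
  proof -
    have out': "?H (x, t) = 0" if "t \<notin> {a<..<b}" for t
    proof -
      have "(x, t) \<notin> S" using ab(3) that by auto
      then show ?thesis using out by simp
    qed
    have "integrable lborel (\<lambda>t. ?H (x, t))"
    proof (rule integrable_bounded_support)
      show "(\<lambda>t. ?H (x, t)) \<in> borel_measurable borel" by measurable
      show "\<bar>?H (x, t)\<bar> \<le> C * A + M * A'" for t
        using b1[of "(x, t)"] b2[of "(x, t)"] by linarith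
      show "bounded {a<..<b}" by simp
    qed (use out' in auto)
    \<comment> \<open>The Lebesgue integral is restated as a gauge integral, so that uniqueness of
      gauge integrals can compare it with the value from the fundamental theorem.\<close>
    then have 1: "((\<lambda>t. ?H (x, t)) has_integral (\<integral>t. ?H (x, t) \<partial>lborel)) UNIV"
      by (rule has_integral_integral_lborel)
    have "((\<lambda>t. w (x, t) * \<phi> (x, t)) has_real_derivative ?H (x, t)) (at t)" if "t \<in> {a..b}" for t
    proof -
      have "((\<lambda>s. \<phi> ((x, 0) + s *\<^sub>R (0, 1))) has_real_derivative dir_deriv (0, 1) \<phi> ((x, 0) + t *\<^sub>R (0, 1))) (at t)"
        by (intro has_real_derivative_line C0_inf_differentiable[OF \<phi>])
      then have "((\<lambda>s. \<phi> (x, s)) has_real_derivative time_deriv \<phi> (x, t)) (at t)"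
        by (simp add: time_deriv_def)
      from DERIV_mult[OF ode[OF x, of t] this] show ?thesis
        using that ab(1) by (simp add: add.commute mult.commute)
    qed
    then have "((\<lambda>t. ?H (x, t)) has_integral (w (x, b) * \<phi> (x, b) - w (x, a) * \<phi> (x, a))) {a..b}"
      using ab(2) by (intro fundamental_theorem_of_calculus)
        (auto simp: has_real_derivative_iff_has_vector_derivative[symmetric] intro: has_field_derivative_at_within)
    moreover have "\<phi> (x, b) = 0" "\<phi> (x, a) = 0"
      using out(1)[of "(x, b)"] out(1)[of "(x, a)"] ab(3)[of x a] ab(3)[of x b] by auto
    ultimately have "((\<lambda>t. ?H (x, t)) has_integral 0) {a..b}" by simp
    then have 2: "((\<lambda>t. ?H (x, t)) has_integral 0) UNIV"
      by (rule has_integral_on_superset) (use out' in auto)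
    show ?thesis using has_integral_unique[OF 1 2] .
  qed
  have "integral\<^sup>L lborel ?H = (\<integral>x. (\<integral>t. ?H (x, t) \<partial>lborel) \<partial>lborel)"
    using lborel_pair.integral_fst'[of ?H] int unfolding lborel_prod by simp
  also have "\<dots> = 0"
    by (rule integral_eq_zero_AE) (use zero AE_not_in[OF N] in \<open>auto elim!: eventually_mono\<close>)
  finally show ?thesis using int1 int2 by simp
qed

text \<open>For fixed \<open>y\<close>, the translation by \<open>h *\<^sub>R (y, 0)\<close> moves
  the shift from \<open>w\<close> to \<open>\<phi>\<close> and thereby turns \<open>- h\<close> into
  \<open>h\<close>. Exchanging the order of integration on both sides requires integrability jointly
  in \<open>y\<close> and \<open>z\<close>.\<close>

lemma nonlocal_op_adjoint:
  fixes J :: "'a::euclidean_space \<Rightarrow> real" and w \<phi> :: "'a \<times> real \<Rightarrow> real"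
  assumes J: "C0_inf UNIV J" and \<phi>: "C0_inf \<Omega> \<phi>"
    and w: "w \<in> borel_measurable borel" "\<And>z. 0 \<le> w z" "\<And>z. w z \<le> M"
  shows "(\<integral>z. nonlocal_op J (- h) w z * \<phi> z \<partial>lborel) = (\<integral>z. w z * nonlocal_op J h \<phi> z \<partial>lborel)"
proof -
  define S where "S = closure {z. \<phi> z \<noteq> 0}"
  define SJ where "SJ = closure {z. J z \<noteq> 0}"
  \<comment> \<open>\<open>?K\<close> collects the points that some shift, with \<open>y\<close> in
    the support of \<open>J\<close>, carries into the support of \<open>\<phi>\<close>. Together
    with \<open>S\<close> it confines both double integrands to a bounded set.\<close>
  let ?K = "(\<lambda>(y, s). s - h *\<^sub>R (y, 0)) ` (SJ \<times> S)"
  have S: "compact S" "compact SJ" using \<phi> J by (auto simp: C0_inf_def S_def SJ_def)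
  have "compact ?K"
    using S by (intro compact_continuous_image compact_Times) (auto simp: case_prod_unfold intro!: continuous_intros)
  then have bdd: "bounded (SJ \<times> (S \<union> ?K))" "bounded S"
    using S by (auto intro!: compact_imp_bounded compact_Times compact_Un)
  note [measurable] = w(1) C0_inf_borel_measurable[OF \<phi>] C0_inf_borel_measurable[OF J]
  obtain A where A: "0 \<le> A" "\<And>z. \<bar>\<phi> z\<bar> \<le> A" using C0_inf_bounded[OF \<phi>] by blast
  obtain B where B: "0 \<le> B" "\<And>z. \<bar>J z\<bar> \<le> B" using C0_inf_bounded[OF J] by blast
  have M: "0 \<le> M" using w(2,3) order_trans by blast
  let ?D = "\<lambda>y z. J y * (w (z + (- h) *\<^sub>R (y, 0)) - w z) * \<phi> z"
  let ?E = "\<lambda>y z. w z * (J y * (\<phi> (z + h *\<^sub>R (y, 0)) - \<phi> z))"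
  have outJ: "J y = 0" if "y \<notin> SJ" for y using that unfolding SJ_def by (rule zero_outside_support)
  have out: "\<phi> z = 0" if "z \<notin> S" for z using that unfolding S_def by (rule zero_outside_support)
  have out': "\<phi> (z + h *\<^sub>R (y, 0)) = 0" if "y \<in> SJ" "z \<notin> ?K" for y z
  proof (rule out)
    show "z + h *\<^sub>R (y, 0) \<notin> S"
      using that by (auto simp: image_iff) (metis add_diff_cancel_right' scaleR_Pair scaleR_zero_right)
  qed
  have intD: "integrable (lborel \<Otimes>\<^sub>M lborel) (case_prod ?D)"
    unfolding lborel_prod
  proof (rule integrable_bounded_support[OF _ _ bdd(1)])
    have "case_prod ?D \<in> borel_measurable (borel \<Otimes>\<^sub>M borel)" by measurable
    then show "case_prod ?D \<in> borel_measurable borel" by (simp only: borel_prod)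
    show "\<bar>case_prod ?D yz\<bar> \<le> B * M * A" for yz
    proof -
      obtain y z where yz: "yz = (y, z)" by (rule prod.exhaust)
      have "\<bar>w (z + (- h) *\<^sub>R (y, 0)) - w z\<bar> \<le> M"
        using w(2,3)[of z] w(2,3)[of "z + (- h) *\<^sub>R (y, 0)"] by linarith
      then show ?thesis unfolding yz case_prod_conv abs_mult using A B M by (intro mult_mono) auto
    qed
    show "case_prod ?D yz = 0" if "yz \<notin> SJ \<times> (S \<union> ?K)" for yz
      using that outJ[of "fst yz"] out[of "snd yz"] by (auto simp: case_prod_unfold mem_Times_iff)
  qed
  have intE: "integrable (lborel \<Otimes>\<^sub>M lborel) (case_prod ?E)"
    unfolding lborel_prod
  proof (rule integrable_bounded_support[OF _ _ bdd(1)])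
    have "case_prod ?E \<in> borel_measurable (borel \<Otimes>\<^sub>M borel)" by measurable
    then show "case_prod ?E \<in> borel_measurable borel" by (simp only: borel_prod)
    show "\<bar>case_prod ?E yz\<bar> \<le> M * (B * (2 * A))" for yz
    proof -
      obtain y z where yz: "yz = (y, z)" by (rule prod.exhaust)
      have "\<bar>\<phi> (z + h *\<^sub>R (y, 0)) - \<phi> z\<bar> \<le> 2 * A"
        using A(2)[of z] A(2)[of "z + h *\<^sub>R (y, 0)"] by linarith
      then show ?thesis unfolding yz case_prod_conv abs_mult using A B M w(2,3)[of z] by (intro mult_mono) auto
    qed
    show "case_prod ?E yz = 0" if "yz \<notin> SJ \<times> (S \<union> ?K)" for yz
    proof (cases "fst yz \<in> SJ")
      case True
      then have "snd yz \<notin> S" "snd yz \<notin> ?K" using that by (auto simp: mem_Times_iff)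
      then show ?thesis using out[of "snd yz"] out'[OF True] by (simp add: case_prod_unfold)
    qed (use outJ in \<open>simp add: case_prod_unfold\<close>)
  qed
  have eq: "(\<integral>z. ?D y z \<partial>lborel) = (\<integral>z. ?E y z \<partial>lborel)" for y
  proof -
    let ?g = "\<lambda>z. w (z + (- h) *\<^sub>R (y, 0)) * \<phi> z" and ?k = "\<lambda>z. w z * \<phi> z"
    let ?g' = "\<lambda>z. w z * \<phi> (z + h *\<^sub>R (y, 0))"
    have b: "\<bar>w z' * \<phi> z\<bar> \<le> M * A" for z z'
      unfolding abs_mult using A M w(2,3)[of z'] by (intro mult_mono) auto
    have i: "integrable lborel ?g" "integrable lborel ?k"
      by (rule integrable_bounded_support[OF _ b bdd(2)]; use out in simp)+
    have shift: "?g (h *\<^sub>R (y, 0) + z) = ?g' z" for z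
    proof -
      have "h *\<^sub>R (y, 0) + z + (- h) *\<^sub>R (y, 0) = z"
        by (simp only: scaleR_minus_left) (simp only: add_uminus_conv_diff add_diff_cancel_left')
      then show ?thesis by (simp only: add.commute[of "h *\<^sub>R (y, 0)" z])
    qed
    have i': "integrable lborel ?g'"
      using i(1) integrable_distr[of "(+) (h *\<^sub>R (y, 0))" lborel borel ?g]
      unfolding lborel_distr_plus shift by simp
    have "(\<integral>z. ?g z \<partial>lborel) = (\<integral>z. ?g (h *\<^sub>R (y, 0) + z) \<partial>lborel)"
      by (rule integral_lborel_distr[OF lborel_distr_plus, symmetric]) measurable
    then have g: "(\<integral>z. ?g z \<partial>lborel) = (\<integral>z. ?g' z \<partial>lborel)" unfolding shift .
    have "(\<integral>z. ?D y z \<partial>lborel) = (\<integral>z. J y * (?g z - ?k z) \<partial>lborel)"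
      by (simp add: algebra_simps)
    also have "\<dots> = J y * ((\<integral>z. ?g z \<partial>lborel) - (\<integral>z. ?k z \<partial>lborel))"
      using i by simp
    also have "\<dots> = (\<integral>z. J y * (?g' z - ?k z) \<partial>lborel)"
      unfolding g using i(2) i' by simp
    also have "\<dots> = (\<integral>z. ?E y z \<partial>lborel)"
      by (simp add: algebra_simps)
    finally show ?thesis .
  qed
  have "(\<integral>z. nonlocal_op J (- h) w z * \<phi> z \<partial>lborel) = (\<integral>z. (\<integral>y. ?D y z \<partial>lborel) \<partial>lborel)"
    by (simp add: nonlocal_op_def)
  also have "\<dots> = (\<integral>y. (\<integral>z. ?D y z \<partial>lborel) \<partial>lborel)"
    by (rule lborel_pair.Fubini_integral[OF intD])
  also have "\<dots> = (\<integral>y. (\<integral>z. ?E y z \<partial>lborel) \<partial>lborel)"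
    by (simp only: eq)
  also have "\<dots> = (\<integral>z. (\<integral>y. ?E y z \<partial>lborel) \<partial>lborel)"
    by (rule lborel_pair.Fubini_integral[OF intE, symmetric])
  also have "\<dots> = (\<integral>z. w z * nonlocal_op J h \<phi> z \<partial>lborel)"
    by (simp add: nonlocal_op_def)
  finally show ?thesis .
qed

text \<open>Shifts in space do not alter the time coordinate, so enlarging the support of
  \<open>\<phi>\<close> in the space directions keeps it inside \<open>spacetime\<close>. A single
  \<open>K\<close> for all \<open>h\<close> with \<open>\<bar>h\<bar> \<le> 1\<close> is what lets
  one majorant serve the whole sequence.\<close>

lemma nonlocal_op_support:
  fixes J :: "'a::euclidean_space \<Rightarrow> real"
  assumes J: "C0_inf UNIV J" and \<phi>: "C0_inf spacetime \<phi>"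
  obtains K where "compact K" "K \<subseteq> spacetime"
    "\<And>z. z \<notin> K \<Longrightarrow> \<phi> z = 0" "\<And>z. z \<notin> K \<Longrightarrow> time_deriv \<phi> z = 0"
    "\<And>h z. \<bar>h\<bar> \<le> 1 \<Longrightarrow> z \<notin> K \<Longrightarrow> nonlocal_op J h \<phi> z = 0"
proof -
  define S where "S = closure {z. \<phi> z \<noteq> 0}"
  define SJ where "SJ = closure {z. J z \<noteq> 0}"
  have S: "compact S" "S \<subseteq> spacetime" "compact SJ" using \<phi> J by (auto simp: C0_inf_def S_def SJ_def)
  obtain R where R: "SJ \<subseteq> cball 0 R" "0 < R"
    using bounded_subset_ballD[OF compact_imp_bounded[OF S(3)], of 0] ball_subset_cball by (metis order_trans)
  \<comment> \<open>A full ball replaces the support of \<open>J\<close>: together with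
    \<open>y\<close> it contains \<open>h *\<^sub>R y\<close> for every \<open>h\<close> with
    \<open>\<bar>h\<bar> \<le> 1\<close>, and its centre gives the inclusion of
    \<open>S\<close>.\<close>
  let ?K = "(\<lambda>(y, s). s - (y, 0)) ` (cball 0 R \<times> S)"
  have K: "z \<in> ?K" if "z + (y, 0) \<in> S" "norm y \<le> R" for z y
    using that by (intro image_eqI[of _ _ "(y, z + (y, 0))"]) auto
  have out: "\<phi> z = 0" "time_deriv \<phi> z = 0" if "z \<notin> S" for z
    unfolding time_deriv_def by (rule zero_outside_support[OF that[unfolded S_def]], rule dir_deriv_zero[OF that[unfolded S_def]])
  have sub: "z \<notin> S" if "z \<notin> ?K" for z
    using K[of z 0] that R(2) by (auto simp: zero_prod_def[symmetric])
  show ?thesis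
  proof (rule that)
    show "compact ?K"
      using S by (intro compact_continuous_image compact_Times) (auto simp: case_prod_unfold intro!: continuous_intros)
    show "?K \<subseteq> spacetime" using S(2) by (auto simp: spacetime_def)
    show "\<phi> z = 0" "time_deriv \<phi> z = 0" if "z \<notin> ?K" for z
      using out[OF sub[OF that]] by auto
    show "nonlocal_op J h \<phi> z = 0" if h: "\<bar>h\<bar> \<le> 1" and z: "z \<notin> ?K" for h z
    proof -
      have "J y * (\<phi> (z + h *\<^sub>R (y, 0)) - \<phi> z) = 0" for y
      proof (cases "y \<in> SJ")
        case True
        then have "norm y \<le> R" using R(1) by auto
        then have "norm (h *\<^sub>R y) \<le> R"
          using mult_mono[OF h, of "norm y" R] by simp
        then have "z + h *\<^sub>R (y, 0) \<notin> S" using K[of z "h *\<^sub>R y"] z by auto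
        then show ?thesis using out sub[OF z] by simp
      next
        case False
        then show ?thesis using zero_outside_support[of y J] by (simp add: SJ_def)
      qed
      then show ?thesis unfolding nonlocal_op_def by (simp only: Bochner_Integration.integral_zero)
    qed
  qed
qed

text \<open>Rescaling by \<open>k\<close> will supply \<open>h = 1 / k\<close>,
  \<open>\<alpha> = k\<^sup>2\<close> and \<open>\<beta> = F(k)\<close>. The bound \<open>M\<close>
  may depend on the scale: it only secures integrability over the compact set \<open>K\<close> and
  does not enter the identity.\<close>

lemma weak_form:
  fixes J :: "'a::euclidean_space \<Rightarrow> real" and w \<phi> :: "'a \<times> real \<Rightarrow> real"
  assumes J: "C0_inf UNIV J" and \<phi>: "C0_inf spacetime \<phi>" and h: "\<bar>h\<bar> \<le> 1" and p: "0 \<le> p"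
    and w: "w \<in> borel_measurable borel" "\<And>z. 0 \<le> w z" "\<And>z. w z \<le> M"
    and N: "N \<in> null_sets lborel"
    and ode: "\<And>x t. x \<notin> N \<Longrightarrow> 0 < t \<Longrightarrow> ((\<lambda>s. w (x, s)) has_real_derivative
        \<alpha> * nonlocal_op J (- h) w (x, t) - \<beta> * w (x, t) powr p) (at t)"
  shows "(\<integral>z. w z * (time_deriv \<phi> z + \<alpha> * nonlocal_op J h \<phi> z) \<partial>lborel) = \<beta> * (\<integral>z. w z powr p * \<phi> z \<partial>lborel)"
proof -
  obtain K where K: "compact K" "K \<subseteq> spacetime"
    "\<And>z. z \<notin> K \<Longrightarrow> \<phi> z = 0" "\<And>z. z \<notin> K \<Longrightarrow> time_deriv \<phi> z = 0"
    "\<And>z. z \<notin> K \<Longrightarrow> nonlocal_op J h \<phi> z = 0"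
    using nonlocal_op_support[OF J \<phi>] h by metis
  have bK: "bounded K" using K(1) by (rule compact_imp_bounded)
  have \<phi>': "C0_inf spacetime (time_deriv \<phi>)"
    unfolding time_deriv_def by (intro C0_inf_dir_deriv[OF \<phi>]) (simp add: Basis_prod_def)
  have intJ: "integrable lborel J"
    using C0_inf_mult_integrable[OF J, of "\<lambda>_. 1"] by simp
  note [measurable] = w(1) C0_inf_borel_measurable[OF \<phi>] C0_inf_borel_measurable[OF \<phi>'] C0_inf_borel_measurable[OF J]
  have [measurable]: "nonlocal_op J k w \<in> borel_measurable borel" "nonlocal_op J k \<phi> \<in> borel_measurable borel" for k
    by (intro nonlocal_op_measurable; measurable)+
  obtain A where A: "0 \<le> A" "\<And>z. \<bar>\<phi> z\<bar> \<le> A" using C0_inf_bounded[OF \<phi>] by blast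
  obtain A' where A': "0 \<le> A'" "\<And>z. \<bar>time_deriv \<phi> z\<bar> \<le> A'" using C0_inf_bounded[OF \<phi>'] by blast
  define L where "L = (\<integral>y. \<bar>J y\<bar> * M \<partial>lborel)"
  have L: "\<bar>nonlocal_op J k w z\<bar> \<le> L" for k z
    unfolding L_def by (rule nonlocal_op_bounded[OF intJ w])
  have L0: "0 \<le> L" using L[of 0 undefined] by simp
  have M: "0 \<le> M" using w(2,3) order_trans by blast
  have wp: "\<bar>w z powr p\<bar> \<le> M powr p" for z using w(2,3)[of z] p by (simp add: powr_mono2)
  let ?G = "\<lambda>z. \<alpha> * nonlocal_op J (- h) w z - \<beta> * w z powr p"
  have G: "\<bar>?G z\<bar> \<le> \<bar>\<alpha>\<bar> * L + \<bar>\<beta>\<bar> * M powr p" for z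
  proof -
    have "\<bar>\<alpha> * nonlocal_op J (- h) w z\<bar> \<le> \<bar>\<alpha>\<bar> * L" "\<bar>\<beta> * w z powr p\<bar> \<le> \<bar>\<beta>\<bar> * M powr p"
      unfolding abs_mult by (rule mult_left_mono[OF L abs_ge_zero], rule mult_left_mono[OF wp abs_ge_zero])
    then show ?thesis by linarith
  qed
  have eq: "(\<integral>z. ?G z * \<phi> z \<partial>lborel) + (\<integral>z. w z * time_deriv \<phi> z \<partial>lborel) = 0"
  proof (rule time_deriv_weak[OF \<phi> w(1) _ _ G N ode])
    show "\<bar>w z\<bar> \<le> M" for z using w(2,3)[of z] by simp
  qed measurable
  have i1: "integrable lborel (\<lambda>z. nonlocal_op J (- h) w z * \<phi> z)"
  proof (rule integrable_bounded_support[OF _ _ bK])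
    show "\<bar>nonlocal_op J (- h) w z * \<phi> z\<bar> \<le> L * A" for z
      unfolding abs_mult using L A L0 by (intro mult_mono) auto
  qed (use K in auto)
  have i2: "integrable lborel (\<lambda>z. w z powr p * \<phi> z)"
  proof (rule integrable_bounded_support[OF _ _ bK])
    show "\<bar>w z powr p * \<phi> z\<bar> \<le> M powr p * A" for z
      unfolding abs_mult using wp A by (intro mult_mono) auto
  qed (use K in auto)
  have i3: "integrable lborel (\<lambda>z. w z * time_deriv \<phi> z)"
  proof (rule integrable_bounded_support[OF _ _ bK])
    show "\<bar>w z * time_deriv \<phi> z\<bar> \<le> M * A'" for z
      unfolding abs_mult using w(2,3)[of z] A' M by (intro mult_mono) auto
  qed (use K in auto)
  have nl: "\<bar>nonlocal_op J h \<phi> z\<bar> \<le> (\<integral>y. \<bar>J y\<bar> * (2 * A) \<partial>lborel)" for z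
  proof -
    \<comment> \<open>The operator sees differences only, so adding the constant \<open>A\<close>
      changes nothing and yields a function between 0 and \<open>2 * A\<close>, as
      \<open>nonlocal_op_bounded\<close> expects.\<close>
    have "nonlocal_op J h \<phi> z = nonlocal_op J h (\<lambda>z. \<phi> z + A) z" by (simp add: nonlocal_op_def)
    also have "\<bar>\<dots>\<bar> \<le> (\<integral>y. \<bar>J y\<bar> * (2 * A) \<partial>lborel)"
    proof (rule nonlocal_op_bounded[OF intJ])
      show "0 \<le> \<phi> z + A" "\<phi> z + A \<le> 2 * A" for z
        using A(2)[of z] by linarith+
    qed measurable
    finally show ?thesis .
  qed
  have i4: "integrable lborel (\<lambda>z. w z * nonlocal_op J h \<phi> z)"
  proof (rule integrable_bounded_support[OF _ _ bK])
    show "\<bar>w z * nonlocal_op J h \<phi> z\<bar> \<le> M * (\<integral>y. \<bar>J y\<bar> * (2 * A) \<partial>lborel)" for z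
      unfolding abs_mult using w(2,3)[of z] nl[of z] M by (intro mult_mono) auto
  qed (use K in auto)
  have "(\<integral>z. ?G z * \<phi> z \<partial>lborel) = (\<integral>z. \<alpha> * (nonlocal_op J (- h) w z * \<phi> z) - \<beta> * (w z powr p * \<phi> z) \<partial>lborel)"
    by (simp add: algebra_simps)
  also have "\<dots> = \<alpha> * (\<integral>z. nonlocal_op J (- h) w z * \<phi> z \<partial>lborel) - \<beta> * (\<integral>z. w z powr p * \<phi> z \<partial>lborel)"
    using i1 i2 by simp
  also have "(\<integral>z. nonlocal_op J (- h) w z * \<phi> z \<partial>lborel) = (\<integral>z. w z * nonlocal_op J h \<phi> z \<partial>lborel)"
    by (rule nonlocal_op_adjoint[OF J \<phi> w])
  finally have "(\<integral>z. w z * time_deriv \<phi> z \<partial>lborel) + \<alpha> * (\<integral>z. w z * nonlocal_op J h \<phi> z \<partial>lborel) = \<beta> * (\<integral>z. w z powr p * \<phi> z \<partial>lborel)"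
    using eq by simp
  moreover have "(\<integral>z. w z * (time_deriv \<phi> z + \<alpha> * nonlocal_op J h \<phi> z) \<partial>lborel)
      = (\<integral>z. w z * time_deriv \<phi> z + \<alpha> * (w z * nonlocal_op J h \<phi> z) \<partial>lborel)"
    by (simp add: algebra_simps)
  ultimately show ?thesis using i3 i4 by simp
qed

section \<open>Borel versions of solutions\<close>

lemma lborel_distr_minus:
  fixes x :: "'a::euclidean_space"
  shows "distr lborel borel (\<lambda>y. x - y) = lborel"
  using lborel_affine[of "- 1" x] by (simp add: density_1)

text \<open>A solution is only measurable in \<open>x\<close> for each \<open>t\<close>. Since it is continuous in \<open>t\<close>, it is the limit of
  functions that are piecewise constant in \<open>t\<close>; these involve countably many times only, so a single null set is discarded.\<close>

lemma solution_borel_version: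
  fixes J :: "'a::euclidean_space \<Rightarrow> real"
  assumes sol: "nonneg_bounded_solution J p u0 u" and J: "J \<in> borel_measurable borel"
  obtains v M N where "v \<in> borel_measurable borel" "\<And>z. 0 \<le> v z" "\<And>z. v z \<le> M"
    "N \<in> null_sets lborel" "\<And>x t. x \<notin> N \<Longrightarrow> 0 \<le> t \<Longrightarrow> u x t = v (x, t)"
    "\<And>x t. x \<notin> N \<Longrightarrow> 0 < t \<Longrightarrow> ((\<lambda>s. v (x, s)) has_real_derivative
        nonlocal_op J (- 1) v (x, t) - v (x, t) powr p) (at t)"
proof -
  have meas: "(\<lambda>x. u x t) \<in> borel_measurable lebesgue" if "0 \<le> t" for t
    using sol that by (simp add: nonneg_bounded_solution_def)
  obtain M where M: "AE x in lborel. \<forall>t\<ge>0. 0 \<le> u x t \<and> u x t \<le> M"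
    using sol by (auto simp: nonneg_bounded_solution_def AE_completion_iff)
  have eqn: "AE x in lborel. continuous_on {0..} (u x) \<and> (\<forall>t>0. (u x has_real_derivative
       (\<integral>y. J (x - y) * (u y t - u x t) \<partial>lebesgue) - u x t powr p) (at t))"
    using sol by (auto simp: nonneg_bounded_solution_def AE_completion_iff elim: eventually_mono)
  \<comment> \<open>The sample times are the multiples of \<open>1 / (n + 1)\<close>. At each of
    them the Lebesgue measurable slice is replaced by a Borel function, up to a null set.\<close>
  have "\<forall>n i. \<exists>g. g \<in> borel_measurable lborel \<and> (AE x in lborel. u x (real i / real (Suc n)) = g x)"
    by (intro allI completion_ex_borel_measurable_real[OF meas, unfolded Bex_def]) simp
  then obtain g where g: "\<And>n i. g n i \<in> borel_measurable lborel"
      "\<And>n i. AE x in lborel. u x (real i / real (Suc n)) = g n i x"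
    unfolding choice_iff by blast
  note [measurable] = J g(1)
  have "AE x in lborel. \<forall>n i. u x (real i / real (Suc n)) = g n i x"
    using g(2) by (simp add: AE_all_countable)
  with M eqn have "AE x in lborel. (\<forall>t\<ge>0. 0 \<le> u x t \<and> u x t \<le> M) \<and>
      (continuous_on {0..} (u x) \<and> (\<forall>t>0. (u x has_real_derivative
       (\<integral>y. J (x - y) * (u y t - u x t) \<partial>lebesgue) - u x t powr p) (at t))) \<and>
      (\<forall>n i. u x (real i / real (Suc n)) = g n i x)"
    by eventually_elim blast
  then obtain N where N: "N \<in> null_sets lborel"
    and bd: "\<And>x t. x \<notin> N \<Longrightarrow> 0 \<le> t \<Longrightarrow> 0 \<le> u x t \<and> u x t \<le> M"
    and cont: "\<And>x. x \<notin> N \<Longrightarrow> continuous_on {0..} (u x)"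
    and deriv: "\<And>x t. x \<notin> N \<Longrightarrow> 0 < t \<Longrightarrow> (u x has_real_derivative
       (\<integral>y. J (x - y) * (u y t - u x t) \<partial>lebesgue) - u x t powr p) (at t)"
    and ug: "\<And>x n i. x \<notin> N \<Longrightarrow> u x (real i / real (Suc n)) = g n i x"
    by (elim AE_E3) (auto simp del: of_nat_Suc)
  have [measurable]: "N \<in> sets borel" using N by auto
  \<comment> \<open>\<open>W n\<close> rounds the time down to a multiple of
    \<open>1 / (n + 1)\<close>. It is glued from countably many Borel functions of \<open>x\<close>,
    hence jointly Borel.\<close>
  define W where "W = (\<lambda>n (z::'a \<times> real). g n (nat \<lfloor>snd z * real (Suc n)\<rfloor>) (fst z))"
  have [measurable]: "W n \<in> borel_measurable borel" for n
    unfolding W_def borel_prod[symmetric]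
    by (rule measurable_compose_countable[of "\<lambda>i z. g n i (fst z)"]) measurable
  \<comment> \<open>The value 0 at exceptional \<open>x\<close> and at negative times makes the
    bounds hold everywhere. At all other points the sequence converges by continuity in time, so
    \<open>lim\<close> is a genuine limit there.\<close>
  define v where "v = (\<lambda>z. if fst z \<in> N \<or> snd z < 0 then 0 else lim (\<lambda>n. W n z))"
  have v_meas[measurable]: "v \<in> borel_measurable borel"
  proof -
    have "N \<times> UNIV \<union> UNIV \<times> {..<0} \<in> sets (borel \<Otimes>\<^sub>M borel :: ('a \<times> real) measure)"
      by (intro sets.Un pair_measureI) auto
    also have "N \<times> UNIV \<union> UNIV \<times> {..<0} = {z :: 'a \<times> real. fst z \<in> N \<or> snd z < 0}" by auto
    finally have "{z :: 'a \<times> real. fst z \<in> N \<or> snd z < 0} \<in> sets borel"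
      unfolding borel_prod .
    then show ?thesis
      unfolding v_def by (intro measurable_If borel_measurable_lim_metric) simp_all
  qed
  have uv: "u x t = v (x, t)" if x: "x \<notin> N" and t: "0 \<le> t" for x t
  proof -
    let ?s = "\<lambda>n. real (nat \<lfloor>t * real (Suc n)\<rfloor>) / real (Suc n)"
    have "?s \<longlonglongrightarrow> t"
    proof (rule real_tendsto_sandwich)
      show "(\<lambda>n. t - 1 / real (Suc n)) \<longlonglongrightarrow> t"
        using tendsto_diff[OF tendsto_const LIMSEQ_inverse_real_of_nat, of t] by (simp add: inverse_eq_divide)
      show "\<forall>\<^sub>F n in sequentially. t - 1 / real (Suc n) \<le> ?s n"
      proof (intro always_eventually allI)
        fix n
        have "t * real (Suc n) - 1 \<le> real (nat \<lfloor>t * real (Suc n)\<rfloor>)" using t by linarith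
        then have "(t * real (Suc n) - 1) / real (Suc n) \<le> ?s n" by (rule divide_right_mono) simp
        then show "t - 1 / real (Suc n) \<le> ?s n" by (simp add: diff_divide_distrib del: of_nat_Suc)
      qed
      show "\<forall>\<^sub>F n in sequentially. ?s n \<le> t"
        using t by (intro always_eventually allI) (simp add: divide_le_eq del: of_nat_Suc)
    qed simp
    then have "(\<lambda>n. u x (?s n)) \<longlonglongrightarrow> u x t"
      using t by (intro continuous_on_tendsto_compose[OF cont[OF x]]) auto
    then have "(\<lambda>n. W n (x, t)) \<longlonglongrightarrow> u x t"
      using ug[OF x] by (simp add: W_def del: of_nat_Suc)
    then show ?thesis using x t by (simp add: v_def limI)
  qed
  show ?thesis
  proof (rule that[of v "max M 0" N])
    show "0 \<le> v z" "v z \<le> max M 0" for z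
    proof -
      have "0 \<le> v (x, t) \<and> v (x, t) \<le> max M 0" for x t
        using uv[of x t] bd[of x t] by (cases "x \<in> N \<or> t < 0") (auto simp: v_def)
      then show "0 \<le> v z" "v z \<le> max M 0" by (metis prod.exhaust)+
    qed
    fix x t assume x: "x \<notin> N" and t: "0 < (t::real)"
    \<comment> \<open>The integral runs over all \<open>y\<close> at the single time
      \<open>t\<close>; there \<open>u\<close> and \<open>v\<close> agree except for
      \<open>y\<close> in the null set \<open>N\<close>.\<close>
    have "(\<integral>y. J (x - y) * (u y t - u x t) \<partial>lebesgue) = (\<integral>y. J (x - y) * (v (y, t) - v (x, t)) \<partial>lebesgue)"
    proof (rule integral_cong_AE)
      have [measurable]: "(\<lambda>x. u x t) \<in> borel_measurable lebesgue" using meas t by simp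
      have [measurable]: "(\<lambda>y. J (x - y)) \<in> borel_measurable lebesgue"
        by (rule measurable_completion) measurable
      show "(\<lambda>y. J (x - y) * (u y t - u x t)) \<in> borel_measurable lebesgue" by measurable
      show "(\<lambda>y. J (x - y) * (v (y, t) - v (x, t))) \<in> borel_measurable lebesgue"
        by (rule measurable_completion) measurable
      have "AE y in lborel. y \<notin> N" using N by (rule AE_not_in)
      then show "AE y in lebesgue. J (x - y) * (u y t - u x t) = J (x - y) * (v (y, t) - v (x, t))"
        unfolding AE_completion_iff by eventually_elim (use uv x t in simp)
    qed
    also have "\<dots> = (\<integral>y. J (x - y) * (v (y, t) - v (x, t)) \<partial>lborel)"
      by (rule integral_completion) measurable
    also have "\<dots> = (\<integral>y. J (x - (x - y)) * (v (x - y, t) - v (x, t)) \<partial>lborel)"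
      by (rule integral_lborel_distr[OF lborel_distr_minus, symmetric]) measurable
    also have "\<dots> = nonlocal_op J (- 1) v (x, t)"
      by (simp add: nonlocal_op_def)
    finally have "(u x has_real_derivative nonlocal_op J (- 1) v (x, t) - v (x, t) powr p) (at t)"
      using deriv[OF x t] uv[OF x, of t] t by simp
    \<comment> \<open>Agreement of \<open>u x\<close> with \<open>v\<close> is known for nonnegative
      times only, so the derivative is transferred within the open half-line.\<close>
    then show "((\<lambda>s. v (x, s)) has_real_derivative nonlocal_op J (- 1) v (x, t) - v (x, t) powr p) (at t)"
      by (rule has_field_derivative_transform_within_open[where S = "{0<..}"]) (use t uv x in auto)
  qed (use N uv v_meas in auto)
qed

section \<open>Passage to the limit\<close>

text \<open>Measurability is asked of the function cut off by \<open>K\<close>, because nothing is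
  known about \<open>U\<close> outside \<open>spacetime\<close>.\<close>

lemma set_integrable_compact_AE_bounded:
  fixes g :: "'b::euclidean_space \<Rightarrow> real"
  assumes K: "compact K" and g: "(\<lambda>z. indicator K z * g z) \<in> borel_measurable lebesgue"
    and bd: "AE z in lebesgue. z \<in> K \<longrightarrow> \<bar>g z\<bar> \<le> C"
  shows "set_integrable lebesgue K g"
  unfolding set_integrable_def real_scaleR_def
proof (rule integrableI_bounded_set[where A = K and B = C])
  show "K \<in> sets lebesgue" using K by (simp add: lmeasurable_compact fmeasurableD)
  show "emeasure lebesgue K < \<infinity>"
    using fmeasurableD2[OF lmeasurable_compact[OF K]] by (simp add: top.not_eq_extremum)
  show "AE z in lebesgue. z \<in> K \<longrightarrow> norm (indicator K z * g z) \<le> C"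
    using bd by eventually_elim auto
qed (use g in auto)

text \<open>Measurability and nonnegativity of \<open>U\<close> are inherited from the almost
  everywhere convergence. The bound \<open>bdd\<close> is local, and its starting index may depend
  on \<open>K\<close>, because the global bounds of \<open>w n\<close> may grow with
  \<open>n\<close>.\<close>

lemma distributional_limit:
  fixes J :: "'a::euclidean_space \<Rightarrow> real" and U :: "'a \<Rightarrow> real \<Rightarrow> real" and w :: "nat \<Rightarrow> 'a \<times> real \<Rightarrow> real"
  assumes J: "C0_inf UNIV J" and radial: "\<And>x y. norm x = norm y \<Longrightarrow> J x = J y" and p: "0 < p"
    and w: "\<And>n. w n \<in> borel_measurable borel" "\<And>n z. 0 \<le> w n z"
    and lim: "AE z in lebesgue. z \<in> spacetime \<longrightarrow> (\<lambda>n. w n z) \<longlonglongrightarrow> case_prod U z"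
    and bdd: "\<And>K. compact K \<Longrightarrow> K \<subseteq> spacetime \<Longrightarrow>
        \<exists>C n0. AE z in lebesgue. z \<in> K \<longrightarrow> (\<forall>n\<ge>n0. w n z \<le> C)"
    and h: "h \<longlonglongrightarrow> 0" "\<And>n. h n \<noteq> 0" "\<And>n. \<bar>h n\<bar> \<le> 1"
    and F: "F \<longlonglongrightarrow> c"
    and weak: "\<And>\<phi> n. C0_inf spacetime \<phi> \<Longrightarrow>
        (\<integral>z. w n z * (time_deriv \<phi> z + nonlocal_op J (h n) \<phi> z / (h n)\<^sup>2) \<partial>lborel) = F n * (\<integral>z. w n z powr p * \<phi> z \<partial>lborel)"
  shows "distributional_solution (diffusion_coeff J) c p U"
proof -
  note w(1)[measurable] C0_inf_borel_measurable[OF J, measurable]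
  \<comment> \<open>\<open>U\<close> is arbitrary at nonpositive times, so it is cut off there.
    Completeness of Lebesgue measure then makes \<open>V\<close> measurable, being almost everywhere
    a limit of Borel functions.\<close>
  define V where "V = (\<lambda>z. indicator spacetime z * case_prod U z)"
  have st[measurable]: "spacetime \<in> sets (borel :: ('a \<times> real) measure)"
    unfolding spacetime_def by (intro borel_open open_Times) auto
  have w_leb[measurable]: "w n \<in> borel_measurable lebesgue" for n
    by (rule measurable_completion) (use w(1) in simp)
  have V[measurable]: "V \<in> borel_measurable lebesgue"
  proof (rule borel_measurable_AE)
    show "(\<lambda>z. indicator spacetime z * lim (\<lambda>n. w n z)) \<in> borel_measurable lebesgue"
      by (rule measurable_completion) measurable
    show "AE z in lebesgue. indicator spacetime z * lim (\<lambda>n. w n z) = V z"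
      using lim by eventually_elim (auto simp: V_def indicator_def limI)
  qed
  have V_U: "V z = case_prod U z" if "z \<in> spacetime" for z using that by (simp add: V_def)
  have limV: "AE z in lebesgue. z \<in> spacetime \<longrightarrow> (\<lambda>n. w n z) \<longlonglongrightarrow> V z \<and> 0 \<le> V z"
    using lim by eventually_elim (auto simp: V_U intro: LIMSEQ_le_const w(2))
  have bddV: "\<exists>C n0. 0 \<le> C \<and> (AE z in lebesgue. z \<in> K \<longrightarrow> 0 \<le> V z \<and> V z \<le> C \<and> (\<forall>n\<ge>n0. w n z \<le> C))"
    if K: "compact K" "K \<subseteq> spacetime" for K
  proof -
    obtain C n0 where C: "AE z in lebesgue. z \<in> K \<longrightarrow> (\<forall>n\<ge>n0. w n z \<le> C)" using bdd[OF K] by blast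
    \<comment> \<open>If \<open>K\<close> is a null set the bound \<open>C\<close> may be negative,
      hence the maximum with 0.\<close>
    have "AE z in lebesgue. z \<in> K \<longrightarrow> 0 \<le> V z \<and> V z \<le> max C 0 \<and> (\<forall>n\<ge>n0. w n z \<le> max C 0)"
      using C limV
    proof eventually_elim
      case (elim z)
      show ?case
      proof
        assume z: "z \<in> K"
        then have lim: "(\<lambda>n. w n z) \<longlonglongrightarrow> V z" "0 \<le> V z" and le: "\<And>n. n \<ge> n0 \<Longrightarrow> w n z \<le> C"
          using elim K(2) by auto
        have "V z \<le> C" by (rule LIMSEQ_le_const2[OF lim(1)]) (use le in blast)
        then show "0 \<le> V z \<and> V z \<le> max C 0 \<and> (\<forall>n\<ge>n0. w n z \<le> max C 0)"
          using lim(2) le by (auto intro: order_trans)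
      qed
    qed
    then show ?thesis by (intro exI[of _ "max C 0"] exI[of _ n0]) auto
  qed
  have nonneg: "AE (x, t) in lebesgue. 0 < t \<longrightarrow> 0 \<le> U x t"
    using limV by eventually_elim (auto simp: V_def spacetime_def)
  have loc: "set_integrable lebesgue K (\<lambda>(x, t). U x t)" "set_integrable lebesgue K (\<lambda>(x, t). U x t powr p)"
    if K: "compact K" "K \<subseteq> spacetime" for K
  proof -
    obtain C n0 where C: "0 \<le> C" "AE z in lebesgue. z \<in> K \<longrightarrow> 0 \<le> V z \<and> V z \<le> C \<and> (\<forall>n\<ge>n0. w n z \<le> C)"
      using bddV[OF K] by blast
    have [measurable]: "K \<in> sets lebesgue" using K(1) by (simp add: lmeasurable_compact fmeasurableD)
    show "set_integrable lebesgue K (\<lambda>(x, t). U x t)"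
    proof (rule set_integrable_compact_AE_bounded[OF K(1), where C = C])
      have "(\<lambda>z. indicator K z * V z) \<in> borel_measurable lebesgue" by measurable
      also have "(\<lambda>z. indicator K z * V z) = (\<lambda>z. indicator K z * case_prod U z)"
        using K(2) V_U by (auto simp: indicator_def fun_eq_iff)
      finally show "(\<lambda>z. indicator K z * (case z of (x, t) \<Rightarrow> U x t)) \<in> borel_measurable lebesgue" .
      show "AE z in lebesgue. z \<in> K \<longrightarrow> \<bar>case z of (x, t) \<Rightarrow> U x t\<bar> \<le> C"
        using C(2) by eventually_elim (use K(2) V_U in auto)
    qed
    show "set_integrable lebesgue K (\<lambda>(x, t). U x t powr p)"
    proof (rule set_integrable_compact_AE_bounded[OF K(1), where C = "C powr p"])
      have "(\<lambda>z. indicator K z * V z powr p) \<in> borel_measurable lebesgue" by measurable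
      also have "(\<lambda>z. indicator K z * V z powr p) = (\<lambda>z. indicator K z * (case z of (x, t) \<Rightarrow> U x t powr p))"
        using K(2) V_U by (auto simp: indicator_def fun_eq_iff)
      finally show "(\<lambda>z. indicator K z * (case z of (x, t) \<Rightarrow> U x t powr p)) \<in> borel_measurable lebesgue" .
      show "AE z in lebesgue. z \<in> K \<longrightarrow> \<bar>case z of (x, t) \<Rightarrow> U x t powr p\<bar> \<le> C powr p"
        using C(2)
      proof eventually_elim
        case (elim z)
        show ?case
        proof
          assume z: "z \<in> K"
          then have "V z powr p \<le> C powr p" using elim p by (intro powr_mono2) auto
          then show "\<bar>case z of (x, t) \<Rightarrow> U x t powr p\<bar> \<le> C powr p"
            using z K(2) V_U[of z] by (cases z) auto
        qed
      qed
    qed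
  qed
  have weak_limit: "(LINT (x, t):spacetime|lebesgue. U x t * (time_deriv \<phi> (x, t) + diffusion_coeff J * space_laplacian \<phi> (x, t)))
        = c * (LINT (x, t):spacetime|lebesgue. U x t powr p * \<phi> (x, t))"
    if \<phi>: "C0_inf spacetime \<phi>" for \<phi>
  proof -
    obtain K where K: "compact K" "K \<subseteq> spacetime"
      "\<And>z. z \<notin> K \<Longrightarrow> \<phi> z = 0" "\<And>z. z \<notin> K \<Longrightarrow> time_deriv \<phi> z = 0"
      "\<And>h z. \<bar>h\<bar> \<le> 1 \<Longrightarrow> z \<notin> K \<Longrightarrow> nonlocal_op J h \<phi> z = 0"
      using nonlocal_op_support[OF J \<phi>] by metis
    obtain C n0 where C: "0 \<le> C" "AE z in lebesgue. z \<in> K \<longrightarrow> 0 \<le> V z \<and> V z \<le> C \<and> (\<forall>n\<ge>n0. w n z \<le> C)"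
      using bddV[OF K(1,2)] by blast
    have \<phi>': "C0_inf spacetime (time_deriv \<phi>)"
      unfolding time_deriv_def by (intro C0_inf_dir_deriv[OF \<phi>]) (simp add: Basis_prod_def)
    have K_sets[measurable]: "K \<in> sets lebesgue" using K(1) by (simp add: lmeasurable_compact fmeasurableD)
    have K_fin: "emeasure lebesgue K < \<infinity>"
      using fmeasurableD2[OF lmeasurable_compact[OF K(1)]] by (simp add: top.not_eq_extremum)
    obtain A where A: "0 \<le> A" "\<And>z. \<bar>\<phi> z\<bar> \<le> A" using C0_inf_bounded[OF \<phi>] by blast
    obtain A' where A': "0 \<le> A'" "\<And>z. \<bar>time_deriv \<phi> z\<bar> \<le> A'" using C0_inf_bounded[OF \<phi>'] by blast
    obtain B where B: "\<And>h z. \<bar>nonlocal_op J h \<phi> z\<bar> \<le> B * h\<^sup>2"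
      using nonlocal_op_bound[OF J radial \<phi>] by blast
    define \<psi> where "\<psi> = (\<lambda>n z. time_deriv \<phi> z + nonlocal_op J (h n) \<phi> z / (h n)\<^sup>2)"
    define \<eta> where "\<eta> = (\<lambda>z. time_deriv \<phi> z + diffusion_coeff J * space_laplacian \<phi> z)"
    have \<psi>_lim: "(\<lambda>n. \<psi> n z) \<longlonglongrightarrow> \<eta> z" for z
      unfolding \<psi>_def \<eta>_def by (intro tendsto_intros nonlocal_op_tendsto[OF J radial \<phi> h(1,2)])
    have \<psi>_out: "\<psi> n z = 0" if "z \<notin> K" for n z
      using K(4,5) h(3) that by (simp add: \<psi>_def)
    \<comment> \<open>That \<open>\<eta>\<close> vanishes off \<open>K\<close> is read off from the
      limit of the \<open>\<psi> n\<close>, all of which vanish there; the Laplacian is not examined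
      separately.\<close>
    have \<eta>_out: "\<eta> z = 0" if "z \<notin> K" for z
      using \<psi>_lim[of z] \<psi>_out[OF that] by (simp add: LIMSEQ_const_iff)
    have \<psi>_bd: "\<bar>\<psi> n z\<bar> \<le> A' + B" for n z
    proof -
      have "\<bar>nonlocal_op J (h n) \<phi> z / (h n)\<^sup>2\<bar> \<le> B"
        using B[of "h n" z] h(2)[of n] by (simp add: divide_le_eq)
      then show ?thesis using A'(2)[of z] unfolding \<psi>_def by linarith
    qed
    note [measurable] = C0_inf_borel_measurable[OF \<phi>] C0_inf_borel_measurable[OF \<phi>']
    have [measurable]: "nonlocal_op J k \<phi> \<in> borel_measurable borel" for k
      by (intro nonlocal_op_measurable) measurable
    have \<psi>_meas[measurable]: "\<psi> n \<in> borel_measurable borel" for n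
      unfolding \<psi>_def by measurable
    have \<eta>_meas[measurable]: "\<eta> \<in> borel_measurable borel"
      by (rule borel_measurable_LIMSEQ_metric[OF \<psi>_meas \<psi>_lim])
    have leb[measurable]: "\<phi> \<in> borel_measurable lebesgue" "\<eta> \<in> borel_measurable lebesgue" "\<psi> n \<in> borel_measurable lebesgue" for n
      by (rule measurable_completion; measurable)+
    have intK: "integrable lebesgue (\<lambda>z. indicator K z * D)" for D :: real
      using K_sets K_fin by (intro integrable_mult_left integrable_real_indicator) auto
    \<comment> \<open>The bound by \<open>C\<close> starts at \<open>n0\<close>, while dominated
      convergence asks for a majorant of every term; hence the shift of the index.\<close>
    have 1: "(\<lambda>n. \<integral>z. w (n + n0) z * \<psi> (n + n0) z \<partial>lebesgue) \<longlonglongrightarrow> (\<integral>z. V z * \<eta> z \<partial>lebesgue)"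
    proof (rule integral_dominated_convergence[OF _ _ intK])
      show "AE z in lebesgue. (\<lambda>n. w (n + n0) z * \<psi> (n + n0) z) \<longlonglongrightarrow> V z * \<eta> z"
        using limV
      proof eventually_elim
        case (elim z)
        show ?case
        proof (cases "z \<in> K")
          case True
          then have "(\<lambda>n. w n z * \<psi> n z) \<longlonglongrightarrow> V z * \<eta> z"
            using elim K(2) by (intro tendsto_mult \<psi>_lim) auto
          then show ?thesis by (rule LIMSEQ_ignore_initial_segment)
        next
          case False
          then show ?thesis by (simp add: \<psi>_out \<eta>_out)
        qed
      qed
      show "AE z in lebesgue. norm (w (n + n0) z * \<psi> (n + n0) z) \<le> indicator K z * (C * (A' + B))" for n
        using C(2)
      proof eventually_elim
        case (elim z)
        show ?case
        proof (cases "z \<in> K")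
          case True
          then have "\<bar>w (n + n0) z\<bar> * \<bar>\<psi> (n + n0) z\<bar> \<le> C * (A' + B)"
            using elim C(1) w(2)[of "n + n0" z] \<psi>_bd by (intro mult_mono) auto
          then show ?thesis using True by (simp add: abs_mult)
        qed (simp add: \<psi>_out)
      qed
    qed measurable
    have 2: "(\<lambda>n. \<integral>z. w (n + n0) z powr p * \<phi> z \<partial>lebesgue) \<longlonglongrightarrow> (\<integral>z. V z powr p * \<phi> z \<partial>lebesgue)"
    proof (rule integral_dominated_convergence[OF _ _ intK])
      show "AE z in lebesgue. (\<lambda>n. w (n + n0) z powr p * \<phi> z) \<longlonglongrightarrow> V z powr p * \<phi> z"
        using limV
      proof eventually_elim
        case (elim z)
        show ?case
        proof (cases "z \<in> K")
          case True
          \<comment> \<open>The limit \<open>V z\<close> may be 0; at that point convergence of the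
            powers rests on \<open>p > 0\<close> and on the nonnegativity of
            \<open>w n z\<close>.\<close>
          then have "(\<lambda>n. w n z powr p * \<phi> z) \<longlonglongrightarrow> V z powr p * \<phi> z"
            using elim K(2) p w(2) by (intro tendsto_mult tendsto_powr' tendsto_const) auto
          then show ?thesis by (rule LIMSEQ_ignore_initial_segment)
        next
          case False
          then show ?thesis by (simp add: K(3))
        qed
      qed
      show "AE z in lebesgue. norm (w (n + n0) z powr p * \<phi> z) \<le> indicator K z * (C powr p * A)" for n
        using C(2)
      proof eventually_elim
        case (elim z)
        show ?case
        proof (cases "z \<in> K")
          case True
          then have "w (n + n0) z powr p * \<bar>\<phi> z\<bar> \<le> C powr p * A"
            using elim w(2)[of "n + n0" z] p A by (intro mult_mono powr_mono2) auto
          then show ?thesis using True by (simp add: abs_mult)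
        qed (simp add: K(3))
      qed
    qed measurable
    have eq: "(\<integral>z. w n z * \<psi> n z \<partial>lebesgue) = F n * (\<integral>z. w n z powr p * \<phi> z \<partial>lebesgue)" for n
    proof -
      have "(\<integral>z. w n z * \<psi> n z \<partial>lebesgue) = (\<integral>z. w n z * \<psi> n z \<partial>lborel)"
        by (rule integral_completion) measurable
      moreover have "(\<integral>z. w n z powr p * \<phi> z \<partial>lebesgue) = (\<integral>z. w n z powr p * \<phi> z \<partial>lborel)"
        by (rule integral_completion) measurable
      ultimately show ?thesis using weak[OF \<phi>, of n] by (simp add: \<psi>_def)
    qed
    have "(\<lambda>n. F (n + n0) * (\<integral>z. w (n + n0) z powr p * \<phi> z \<partial>lebesgue)) \<longlonglongrightarrow> c * (\<integral>z. V z powr p * \<phi> z \<partial>lebesgue)"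
      by (intro tendsto_mult LIMSEQ_ignore_initial_segment[OF F] 2)
    then have "(\<integral>z. V z * \<eta> z \<partial>lebesgue) = c * (\<integral>z. V z powr p * \<phi> z \<partial>lebesgue)"
      using 1 unfolding eq by (rule LIMSEQ_unique[rotated])
    moreover have "(LINT (x, t):spacetime|lebesgue. U x t * (time_deriv \<phi> (x, t) + diffusion_coeff J * space_laplacian \<phi> (x, t)))
        = (\<integral>z. V z * \<eta> z \<partial>lebesgue)"
      unfolding set_lebesgue_integral_def
      by (intro Bochner_Integration.integral_cong refl) (auto simp: V_def \<eta>_def)
    \<comment> \<open>Outside \<open>spacetime\<close> the function \<open>V\<close> is 0 and
      \<open>0 powr p = 0\<close>, which absorbs the indicator.\<close>
    moreover have "(LINT (x, t):spacetime|lebesgue. U x t powr p * \<phi> (x, t)) = (\<integral>z. V z powr p * \<phi> z \<partial>lebesgue)"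
      unfolding set_lebesgue_integral_def
      by (intro Bochner_Integration.integral_cong refl) (auto simp: V_def indicator_def)
    ultimately show ?thesis by simp
  qed
  show ?thesis
    unfolding distributional_solution_def locally_integrable_on_def
    using nonneg loc weak_limit by blast
qed

section \<open>Scaling and the rescaled solutions\<close>

text \<open>Up to a constant density, \<open>lborel\<close> is its own image under division by
  \<open>c\<close>. This turns the exceptional set of the solution into that of each rescaled
  solution.\<close>

lemma null_sets_lborel_scaleR_vimage:
  fixes P :: "'a::euclidean_space \<Rightarrow> bool"
  assumes c: "c \<noteq> 0" and N: "N \<in> null_sets lborel"
  shows "(\<lambda>x::'a. c *\<^sub>R x) -` N \<in> null_sets lborel"
proof -
  have N': "N \<in> sets borel" using N by auto
  have meas: "(\<lambda>x::'a. c *\<^sub>R x) -` N \<in> sets borel"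
    using measurable_sets[of "\<lambda>x::'a. c *\<^sub>R x" borel borel N] N' by simp
  have "AE x in lborel. x \<notin> (\<lambda>x::'a. c *\<^sub>R x) -` N"
  proof (subst lborel_affine[of "1 / c" 0])
    show "AE x in density (distr lborel borel (\<lambda>x::'a. 0 + (1 / c) *\<^sub>R x)) (\<lambda>_. \<bar>1 / c\<bar> ^ DIM('a)). x \<notin> (\<lambda>x. c *\<^sub>R x) -` N"
      using c AE_not_in[OF N] N' meas by (subst AE_density, simp, subst AE_distr_iff) auto
  qed (use c in simp)
  then show ?thesis using meas by (simp add: AE_iff_null_sets)
qed

text \<open>The ball integral grows with the radius because \<open>u0\<close> is nonnegative, and it
  is finite because \<open>u0\<close> is bounded. It yields \<open>f_scale u0 k > 0\<close> at large
  scales, where a vanishing ball integral would give the default quotient 0.\<close>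

lemma ball_integral_pos:
  fixes u0 :: "'a::euclidean_space \<Rightarrow> real"
  assumes "L_inf u0" "AE x in lebesgue. 0 \<le> u0 x" "0 < ball_integral u0 r" "r \<le> s"
  shows "0 < ball_integral u0 s"
proof -
  obtain M where M: "AE x in lebesgue. \<bar>u0 x\<bar> \<le> M" and [measurable]: "u0 \<in> borel_measurable lebesgue"
    using assms(1) by (auto simp: L_inf_def)
  have int: "integrable lebesgue (\<lambda>x. indicator (ball 0 q) x *\<^sub>R u0 x)" for q
  proof (rule integrableI_bounded_set_indicator)
    show "emeasure lebesgue (ball (0 :: 'a) q) < \<infinity>"
      using fmeasurableD2[OF lmeasurable_ball] by (simp add: top.not_eq_extremum)
    show "AE x in lebesgue. x \<in> ball 0 q \<longrightarrow> norm (u0 x) \<le> M" using M by eventually_elim auto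
  qed simp_all
  have "ball_integral u0 r \<le> ball_integral u0 s"
    unfolding ball_integral_def set_lebesgue_integral_def
    using int int
  proof (rule integral_mono_AE)
    show "AE x in lebesgue. indicator (ball 0 r) x *\<^sub>R u0 x \<le> indicator (ball 0 s) x *\<^sub>R u0 x"
      using assms(2) by eventually_elim (use assms(4) in \<open>auto simp: indicator_def\<close>)
  qed
  then show ?thesis using assms(3) by simp
qed

theorem proposition3p2:
  fixes J u0 :: "'a::euclidean_space \<Rightarrow> real"
    and u U :: "'a \<Rightarrow> real \<Rightarrow> real"
    and p c0 :: real
    and k :: "nat \<Rightarrow> real"
  assumes J_smooth: "C0_inf UNIV J"
    and J_radial: "\<And>x y. norm x = norm y \<Longrightarrow> J x = J y"
    and J_nonneg: "\<And>x. 0 \<le> J x"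
    and J_integral: "(LINT x|lebesgue. J x) = 1"
    and p: "1 < p"
    and u0_Linf: "L_inf u0"
    and u0_nonneg: "AE x in lebesgue. 0 \<le> u0 x"
    and u0_nonzero: "\<not> (AE x in lebesgue. u0 x = 0)"
    and u0_lower: "\<exists>\<kappa>>0. \<exists>\<epsilon>>0. \<forall>r. 0 < r \<and> r < \<epsilon> \<longrightarrow> \<kappa> * r ^ DIM('a) \<le> ball_integral u0 r"
    and F1: "\<exists>B>0. AE x in lebesgue. f_scale u0 (norm x) * u0 x \<le> B"
    and F2: "\<exists>k0>0. \<forall>\<delta>>0. \<exists>C>0. \<forall>r l. k0 \<le> r \<and> r \<le> l * inverse \<delta> \<longrightarrow>
               f_scale u0 r \<le> C * f_scale u0 l"
    and F3: "0 \<le> c0" "(F_scale p u0 \<longlongrightarrow> c0) at_top"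
    and u: "nonneg_bounded_solution J p u0 u"
    and k: "filterlim k at_top sequentially"
    and conv: "\<And>K. compact K \<Longrightarrow> K \<subseteq> spacetime \<Longrightarrow>
                 uniform_limit K (\<lambda>n (x, t). rescaled u0 u (k n) x t) (\<lambda>(x, t). U x t) sequentially"
  shows "distributional_solution (diffusion_coeff J) c0 p U"
proof -
  note J_meas[measurable] = C0_inf_borel_measurable[OF J_smooth]
  obtain v M N where v[measurable]: "v \<in> borel_measurable borel" and v_bd: "\<And>z. 0 \<le> v z" "\<And>z. v z \<le> M"
    and N: "N \<in> null_sets lborel" and uv: "\<And>x t. x \<notin> N \<Longrightarrow> 0 \<le> t \<Longrightarrow> u x t = v (x, t)"
    and v_ode: "\<And>x t. x \<notin> N \<Longrightarrow> 0 < t \<Longrightarrow> ((\<lambda>s. v (x, s)) has_real_derivative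
        nonlocal_op J (- 1) v (x, t) - v (x, t) powr p) (at t)"
    by (rule solution_borel_version[OF u J_meas]) (erule that; assumption)
  obtain \<kappa> \<epsilon> where "0 < \<kappa>" "0 < \<epsilon>" and lower: "\<And>r. 0 < r \<and> r < \<epsilon> \<Longrightarrow> \<kappa> * r ^ DIM('a) \<le> ball_integral u0 r"
    using u0_lower by blast
  \<comment> \<open>Any radius strictly between 0 and \<open>\<epsilon>\<close> would do: the lower
    bound makes the ball integral positive there, and monotonicity extends this to larger
    radii.\<close>
  define r0 where "r0 = \<epsilon> / 2"
  have r0: "0 < ball_integral u0 r0"
    using lower[of r0] \<open>0 < \<epsilon>\<close> \<open>0 < \<kappa>\<close> by (simp add: r0_def) (smt (verit) divide_pos_pos mult_pos_pos zero_less_power)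
  \<comment> \<open>A tail \<open>\<kappa>'\<close> of \<open>k\<close> (unrelated to the constant
    \<open>\<kappa>\<close>) stays above 1, so that \<open>h = 1 / \<kappa>' n\<close> is at most 1,
    and above \<open>r0\<close>, so that \<open>f n\<close> is positive.\<close>
  have "\<forall>\<^sub>F n in sequentially. max 1 r0 \<le> k n"
    using k unfolding filterlim_at_top by blast
  then obtain m where m: "\<And>n. n \<ge> m \<Longrightarrow> max 1 r0 \<le> k n"
    by (auto simp: eventually_sequentially)
  define \<kappa>' where "\<kappa>' = (\<lambda>n. k (n + m))"
  have \<kappa>': "1 \<le> \<kappa>' n" "r0 \<le> \<kappa>' n" for n
    using m[of "n + m"] by (auto simp: \<kappa>'_def)
  have \<kappa>'_lim: "filterlim \<kappa>' at_top sequentially"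
    unfolding \<kappa>'_def by (rule filterlim_compose[OF k filterlim_add_const_nat_at_top])
  define f where "f = (\<lambda>n. f_scale u0 (\<kappa>' n))"
  have f: "0 < f n" for n
    using ball_integral_pos[OF u0_Linf u0_nonneg r0 \<kappa>'(2)[of n]] \<kappa>'(1)[of n]
    by (simp add: f_def f_scale_def)
  define w where "w = (\<lambda>n z. f n * v (\<kappa>' n *\<^sub>R fst z, (\<kappa>' n)\<^sup>2 * snd z))"
  have w_meas[measurable]: "w n \<in> borel_measurable borel" for n
  proof -
    have "(\<lambda>z::'a \<times> real. (\<kappa>' n *\<^sub>R fst z, (\<kappa>' n)\<^sup>2 * snd z)) \<in> borel_measurable borel"
      by (intro borel_measurable_continuous_onI continuous_intros)
    then show ?thesis unfolding w_def by measurable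
  qed
  have w_bd: "0 \<le> w n z" "w n z \<le> f n * M" for n z
    using f[of n] v_bd by (auto simp: w_def)
  define N' where "N' = (\<lambda>n. (\<lambda>x::'a. \<kappa>' n *\<^sub>R x) -` N)"
  have N': "N' n \<in> null_sets lborel" for n
    unfolding N'_def using \<kappa>'(1)[of n] by (intro null_sets_lborel_scaleR_vimage N) simp
  have w_resc: "rescaled u0 u (\<kappa>' n) x t = w n (x, t)" if "x \<notin> N' n" "0 < t" for n x t
    using that uv[of "\<kappa>' n *\<^sub>R x" "(\<kappa>' n)\<^sup>2 * t"] by (simp add: N'_def rescaled_def w_def f_def)
  have AE_fst: "AE z :: 'a \<times> real in lebesgue. \<forall>n. fst z \<notin> N' n"
  proof -
    have "(\<Union>n. N' n) \<times> UNIV \<in> null_sets (lborel \<Otimes>\<^sub>M (lborel :: real measure))"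
      using N' by (intro lborel.times_in_null_sets1 null_sets_UN) auto
    then have "(\<Union>n. N' n) \<times> UNIV \<in> null_sets (lborel :: ('a \<times> real) measure)"
      by (simp add: lborel_prod)
    from AE_completion[OF AE_not_in[OF this]] show ?thesis
      by eventually_elim auto
  qed
  have unif: "\<exists>n0. \<forall>n\<ge>n0. \<forall>(x, t)\<in>K. \<bar>rescaled u0 u (\<kappa>' n) x t - U x t\<bar> < e"
    if K: "compact K" "K \<subseteq> spacetime" and e: "0 < e" for K e
  proof -
    have "\<forall>\<^sub>F n in sequentially. \<forall>z\<in>K. dist (case z of (x, t) \<Rightarrow> rescaled u0 u (k n) x t) (case z of (x, t) \<Rightarrow> U x t) < e"
      using conv[OF K] e unfolding uniform_limit_iff by blast
    then obtain n0 where "\<And>n z. n \<ge> n0 \<Longrightarrow> z \<in> K \<Longrightarrow> dist (case z of (x, t) \<Rightarrow> rescaled u0 u (k n) x t) (case z of (x, t) \<Rightarrow> U x t) < e"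
      unfolding eventually_sequentially by blast
    then show ?thesis
      by (intro exI[of _ n0] allI impI) (force simp: \<kappa>'_def dist_real_def)
  qed
  show ?thesis
  proof (rule distributional_limit[where w = w and h = "\<lambda>n. 1 / \<kappa>' n" and F = "\<lambda>n. F_scale p u0 (\<kappa>' n)"])
    show "AE z in lebesgue. z \<in> spacetime \<longrightarrow> (\<lambda>n. w n z) \<longlonglongrightarrow> case_prod U z"
      using AE_fst
    proof eventually_elim
      case (elim z)
      obtain x t where z: "z = (x, t)" by (rule prod.exhaust)
      show ?case
      proof
        assume st: "z \<in> spacetime"
        then have t: "0 < t" by (simp add: z spacetime_def)
        \<comment> \<open>Pointwise convergence is uniform convergence on the compact set
          \<open>{z}\<close>.\<close>
        have "\<exists>n0. \<forall>n\<ge>n0. \<bar>w n z - U x t\<bar> < e" if "0 < e" for e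
          using unif[of "{z}" e] st that w_resc[OF _ t, of x] elim by (simp add: z)
        then show "(\<lambda>n. w n z) \<longlonglongrightarrow> case_prod U z"
          by (simp add: z LIMSEQ_iff)
      qed
    qed
    show "\<exists>C n0. AE z in lebesgue. z \<in> K \<longrightarrow> (\<forall>n\<ge>n0. w n z \<le> C)" if K: "compact K" "K \<subseteq> spacetime" for K
    proof -
      obtain n0 where n0: "\<And>n x t. n \<ge> n0 \<Longrightarrow> (x, t) \<in> K \<Longrightarrow> \<bar>rescaled u0 u (\<kappa>' n) x t - U x t\<bar> < 1"
        using unif[OF K, of 1] zero_less_one by blast
      \<comment> \<open>Both \<open>w n\<close> and \<open>w n0\<close> are within 1 of
        \<open>U\<close>, hence within 2 of each other, and \<open>f n0 * M\<close> bounds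
        \<open>w n0\<close>. This settles all later \<open>n\<close> with the bound of a single
        scale.\<close>
      have "AE z in lebesgue. z \<in> K \<longrightarrow> (\<forall>n\<ge>n0. w n z \<le> f n0 * M + 2)"
        using AE_fst
      proof eventually_elim
        case (elim z)
        obtain x t where z: "z = (x, t)" by (rule prod.exhaust)
        show ?case
        proof (intro impI allI)
          fix n assume zK: "z \<in> K" and n: "n \<ge> n0"
          have t: "0 < t" using zK K(2) by (auto simp: z spacetime_def)
          have "\<bar>w i z - U x t\<bar> < 1" if "i \<ge> n0" for i
            using n0[OF that, of x t] zK w_resc[OF _ t, of x i] elim by (simp add: z)
          from this[OF n] this[of n0] show "w n z \<le> f n0 * M + 2"
            using w_bd(2)[of n0 z] by linarith
        qed
      qed
      then show ?thesis by blast
    qed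
    show "(\<lambda>n. 1 / \<kappa>' n) \<longlonglongrightarrow> 0"
      by (rule tendsto_divide_0[OF tendsto_const filterlim_at_top_imp_at_infinity[OF \<kappa>'_lim]])
    show "1 / \<kappa>' n \<noteq> 0" "\<bar>1 / \<kappa>' n\<bar> \<le> 1" for n using \<kappa>'(1)[of n] by auto
    show "(\<lambda>n. F_scale p u0 (\<kappa>' n)) \<longlonglongrightarrow> c0"
      by (rule filterlim_compose[OF F3(2) \<kappa>'_lim])
    fix \<phi> :: "'a \<times> real \<Rightarrow> real" and n assume \<phi>: "C0_inf spacetime \<phi>"
    let ?k = "\<kappa>' n"
    have k0: "0 < ?k" using \<kappa>'(1)[of n] by simp
    have "(\<integral>z. w n z * (time_deriv \<phi> z + ?k\<^sup>2 * nonlocal_op J (1 / ?k) \<phi> z) \<partial>lborel)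
        = F_scale p u0 ?k * (\<integral>z. w n z powr p * \<phi> z \<partial>lborel)"
    proof (rule weak_form[OF J_smooth \<phi> _ _ w_meas w_bd N'])
      fix x t assume x: "x \<notin> N' n" and t: "0 < (t::real)"
      let ?y = "?k *\<^sub>R x" and ?s = "?k\<^sup>2 * t"
      have "((\<lambda>s. v (?y, s)) has_real_derivative nonlocal_op J (- 1) v (?y, ?s) - v (?y, ?s) powr p) (at (?k\<^sup>2 * t))"
        using x t k0 by (intro v_ode) (auto simp: N'_def)
      then have "((\<lambda>s. v (?y, ?k\<^sup>2 * s)) has_real_derivative
          (nonlocal_op J (- 1) v (?y, ?s) - v (?y, ?s) powr p) * ?k\<^sup>2) (at t)"
        by (rule DERIV_chain2) (auto intro!: derivative_eq_intros)
      then have "((\<lambda>s. w n (x, s)) has_real_derivative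
          f n * ((nonlocal_op J (- 1) v (?y, ?s) - v (?y, ?s) powr p) * ?k\<^sup>2)) (at t)"
        unfolding w_def fst_conv snd_conv by (rule DERIV_cmult)
      \<comment> \<open>A shift of \<open>x\<close> by \<open>(1 / ?k) *\<^sub>R y\<close> is a
        shift of \<open>?y\<close> by \<open>y\<close>, since \<open>?y\<close> is \<open>x\<close>
        magnified by \<open>?k\<close>.\<close>
      moreover have "nonlocal_op J (- (1 / ?k)) w' (x, t) = f n * nonlocal_op J (- 1) v (?y, ?s)" if "w' = w n" for w'
      proof -
        have "nonlocal_op J (- (1 / ?k)) w' (x, t) = (\<integral>y. f n * (J y * (v ((?y, ?s) + (- 1) *\<^sub>R (y, 0)) - v (?y, ?s))) \<partial>lborel)"
          unfolding nonlocal_op_def that w_def using k0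
          by (intro Bochner_Integration.integral_cong refl) (simp add: algebra_simps)
        then show ?thesis by (simp add: nonlocal_op_def)
      qed
      \<comment> \<open>The exponent \<open>1 - p\<close> in \<open>F_scale\<close> is what turns
        the factor \<open>f n powr p\<close> from the power of \<open>w n\<close> back into the
        single factor \<open>f n\<close> of the rescaled equation.\<close>
      moreover have "F_scale p u0 ?k * w n (x, t) powr p = f n * ?k\<^sup>2 * v (?y, ?s) powr p"
      proof -
        have "f n powr (1 - p) * f n powr p = f n"
          using f[of n] by (simp add: powr_add[symmetric])
        moreover have "w n (x, t) powr p = f n powr p * v (?y, ?s) powr p"
          using f[of n] v_bd(1) by (simp add: w_def powr_mult)
        ultimately show ?thesis by (simp add: F_scale_def f_def)
      qed
      ultimately show "((\<lambda>s. w n (x, s)) has_real_derivative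
          ?k\<^sup>2 * nonlocal_op J (- (1 / ?k)) (w n) (x, t) - F_scale p u0 ?k * w n (x, t) powr p) (at t)"
        by (simp add: algebra_simps)
    qed (use \<kappa>'(1)[of n] p in auto)
    then show "(\<integral>z. w n z * (time_deriv \<phi> z + nonlocal_op J (1 / ?k) \<phi> z / (1 / ?k)\<^sup>2) \<partial>lborel)
        = F_scale p u0 ?k * (\<integral>z. w n z powr p * \<phi> z \<partial>lborel)"
      by (simp add: power_divide mult.commute)
  qed (use p in \<open>simp_all add: J_smooth w_bd w_meas\<close>, rule J_radial)
qed

end
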